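(* Let $V$ be an $n$-dimensional real vector space with dual $V^{*}$, let $\theta,\tau\in\mathrm{End}_{\mathbb{R}}(V)$ be such that $\theta+\tau$ is an isomorphism, and let $a\in\mathcal{S}(V\times V^{*})$. Then $$\mathrm{Op}_{\theta,\tau}(a)=(2\pi)^{-n}\iint\mathcal{F}_{\sigma}(a)(y,p)\,\mathcal{W}_{\theta,\tau}(y,p)\,\mathrm{d}y\,\mathrm{d}p.$$ The integral is taken in the weak sense, i.e. for all $u,v\in\mathcal{S}(V)$ $$\langle\mathrm{Op}_{\theta,\tau}(a)v,u\rangle_{\mathcal{S}'(V),\mathcal{S}(V)}=(2\pi)^{-n}\iint\mathcal{F}_{\sigma}(a)(y,p)\,w_{\theta,\tau,u,v}(y,p)\,\mathrm{d}y\,\mathrm{d}p,$$ where $w_{\theta,\tau,u,v}\in\mathcal{S}(V\times V^{*})$ is given by $w_{\theta,\tau,u,v}(y,p)=\langle\mathcal{W}_{\theta,\tau}(y,p)v,u\rangle_{\mathcal{S}'(V),\mathcal{S}(V)}$.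
   Context: $\mathrm{d}x$ is a Lebesgue measure on $V$ and $\mathrm{d}p$ the dual one on $V^{*}$, such that Fourier's inversion formula holds with constant $(2\pi)^{-n}$. $\langle\cdot,\cdot\rangle_{\mathcal{S}',\mathcal{S}}$ is the bilinear duality, given by $\int fu\,\mathrm{d}x$ for functions. For $a\in\mathcal{S}(V\times V^{*})$ and $v\in\mathcal{S}(V)$, $$\mathrm{Op}_{\theta,\tau}(a)v(x)=(2\pi)^{-n}\iint\mathrm{e}^{\mathrm{i}\langle x-y,p\rangle}a(\theta x+\tau y,p)v(y)\,\mathrm{d}y\,\mathrm{d}p;$$ equivalently $\mathrm{Op}_{\theta,\tau}(a):\mathcal{S}(V)\to\mathcal{S}'(V)$ has the distribution kernel $\big((1\otimes\mathcal{F}_V^{-1})a\big)(\theta x+\tau y,x-y)$, where $\mathcal{F}_V^{-1}$ is the inverse Fourier transform from $V^{*}$ to $V$; this kernel formula extends the definition to $a\in\mathcal{S}'(V\times V^* )$. The canonical symplectic form on $V\times V^{*}$ is $\sigma((x,k);(y,p))=\langle y,k\rangle-\langle x,p\rangle$, and $$\mathcal{F}_{\sigma}(a)(x,k)=(2\pi)^{-n}\iint\mathrm{e}^{-\mathrm{i}\sigma((x,k);(y,p))}a(y,p)\,\mathrm{d}y\,\mathrm{d}p.$$ For $(y,p)\in V\times V^{*}$, $\mathcal{W}_{\theta,\tau}(y,p)=\mathrm{Op}_{\theta,\tau}(\mathrm{e}^{\mathrm{i}\sigma((y,p);\cdot)})$; explicitly $(\mathcal{W}_{\theta,\tau}(y,p)v)(x)=\mathrm{e}^{\mathrm{i}\langle\theta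 x+\tau(x-y),p\rangle}v(x-y)$. *)

theory Defs
  imports "HOL-Analysis.Analysis"
begin

text \<open>
  The vector space \<open>V\<close> is a type of class \<open>euclidean_space\<close>; its inner product is never used to
  identify \<open>V\<close> with its dual. The dual \<open>V\<^sup>*\<close> is the type of (bounded) linear functionals on \<open>V\<close>.
\<close>

type_synonym 'v dual = "'v \<Rightarrow>\<^sub>L real"

text \<open>
  Iterated directional derivatives. A function on a finite-dimensional space is smooth iff all of
  them are Frechet differentiable everywhere.
\<close>

primrec dir_deriv :: "'e::real_normed_vector list \<Rightarrow> ('e \<Rightarrow> complex) \<Rightarrow> 'e \<Rightarrow> complex" where
  "dir_deriv [] f = f"
| "dir_deriv (h # hs) f = (\<lambda>x. frechet_derivative (dir_deriv hs f) (at x) h)"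

definition smooth :: "('e::real_normed_vector \<Rightarrow> complex) \<Rightarrow> bool" where
  "smooth f \<longleftrightarrow> (\<forall>hs x. dir_deriv hs f differentiable (at x))"

definition schwartz :: "('e::real_normed_vector \<Rightarrow> complex) \<Rightarrow> bool" where
  "schwartz f \<longleftrightarrow> smooth f \<and>
     (\<forall>hs (k::nat). \<exists>C. \<forall>x. norm x ^ k * norm (dir_deriv hs f x) \<le> C)"

text \<open>
  A Lebesgue measure on a finite-dimensional space: a nonzero, locally finite, translation
  invariant Borel measure. It is unique up to a positive factor.
\<close>

definition lebesgue_measure :: "'e::real_normed_vector measure \<Rightarrow> bool" where
  "lebesgue_measure M \<longleftrightarrow>
     sets M = sets borel \<and>
     (\<forall>z. distr M borel (\<lambda>x. z + x) = M) \<and>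
     (\<forall>A\<in>sets borel. bounded A \<longrightarrow> emeasure M A < \<infinity>) \<and>
     emeasure M UNIV \<noteq> 0"

text \<open>The normalisation of \<open>dp\<close> relative to \<open>dx\<close> is given by Fourier's inversion formula.\<close>

definition dual_lebesgue_measure ::
    "'v::euclidean_space measure \<Rightarrow> 'v dual measure \<Rightarrow> bool" where
  "dual_lebesgue_measure dx dp \<longleftrightarrow>
     lebesgue_measure dp \<and>
     (\<forall>f. schwartz f \<longrightarrow> (\<forall>x. f x =
        (2 * pi) powi (- int DIM('v)) *
        (\<integral>p. cis (blinfun_apply p x) * (\<integral>y. cis (- blinfun_apply p y) * f y \<partial>dx) \<partial>dp)))"

text \<open>
  Distributions are represented by their values on test functions. The following is the
  distribution given by a function, for the bilinear duality \<open>\<integral> f \<phi>\<close>.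
\<close>

definition distr_of :: "'e measure \<Rightarrow> ('e \<Rightarrow> complex) \<Rightarrow> ('e \<Rightarrow> complex) \<Rightarrow> complex" where
  "distr_of M f \<phi> = (\<integral>x. f x * \<phi> x \<partial>M)"

fun symplectic :: "'v::real_normed_vector \<times> 'v dual \<Rightarrow> 'v \<times> 'v dual \<Rightarrow> real" where
  "symplectic (x, k) (y, p) = blinfun_apply k y - blinfun_apply p x"

definition symplectic_fourier ::
    "'v::euclidean_space measure \<Rightarrow> 'v dual measure \<Rightarrow>
     ('v \<times> 'v dual \<Rightarrow> complex) \<Rightarrow> 'v \<times> 'v dual \<Rightarrow> complex" where
  "symplectic_fourier dx dp a X =
     (2 * pi) powi (- int DIM('v)) * (\<integral>Y. cis (- symplectic X Y) * a Y \<partial>(dx \<Otimes>\<^sub>M dp))"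

text \<open>\<open>Op\<^bsub>\<theta>,\<tau>\<^esub>(a)v\<close> for a Schwartz symbol \<open>a\<close>.\<close>

definition op_schwartz ::
    "'v::euclidean_space measure \<Rightarrow> 'v dual measure \<Rightarrow> ('v \<Rightarrow> 'v) \<Rightarrow> ('v \<Rightarrow> 'v) \<Rightarrow>
     ('v \<times> 'v dual \<Rightarrow> complex) \<Rightarrow> ('v \<Rightarrow> complex) \<Rightarrow> 'v \<Rightarrow> complex" where
  "op_schwartz dx dp \<theta> \<tau> a v x =
     (2 * pi) powi (- int DIM('v)) *
     (\<integral>(y, p). cis (blinfun_apply p (x - y)) * a (\<theta> x + \<tau> y, p) * v y \<partial>(dx \<Otimes>\<^sub>M dp))"

text \<open>
  The extension to tempered symbols \<open>T\<close> goes through the distribution kernel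
  \<open>((1 \<otimes> F\<^sup>-\<^sup>1) T)(\<theta> x + \<tau> y, x - y)\<close>. The partial inverse Fourier transform, from \<open>V \<times> V\<^sup>*\<close>
  to \<open>V \<times> V\<close>, is defined by transposition.
\<close>

definition partial_inv_fourier_distr ::
    "'v::euclidean_space measure \<Rightarrow> (('v \<times> 'v dual \<Rightarrow> complex) \<Rightarrow> complex) \<Rightarrow>
     ('v \<times> 'v \<Rightarrow> complex) \<Rightarrow> complex" where
  "partial_inv_fourier_distr dx T \<phi> =
     T (\<lambda>(z, k). (2 * pi) powi (- int DIM('v)) *
                   (\<integral>s. cis (blinfun_apply k s) * \<phi> (z, s) \<partial>dx))"

text \<open>
  The absolute value of the determinant of a linear endomorphism, as its volume scaling factor.
\<close>

definition abs_det :: "('e::euclidean_space \<Rightarrow> 'e) \<Rightarrow> real" where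
  "abs_det L = measure lborel (L ` cball 0 1) / measure lborel (cball 0 (1::real) :: 'e set)"

text \<open>
  The distribution \<open>T \<circ> L\<close> for a linear isomorphism \<open>L\<close>, extending the change of variables
  \<open>\<integral> f(L x) \<phi>(x) dx = \<bar>det L\<bar>\<^sup>-\<^sup>1 \<integral> f(y) \<phi>(L\<^sup>-\<^sup>1 y) dy\<close>.
\<close>

definition pullback_distr ::
    "('e::euclidean_space \<Rightarrow> 'e) \<Rightarrow> (('e \<Rightarrow> complex) \<Rightarrow> complex) \<Rightarrow> ('e \<Rightarrow> complex) \<Rightarrow> complex" where
  "pullback_distr L T \<phi> = of_real (inverse (abs_det L)) * T (\<lambda>y. \<phi> (inv L y))"

text \<open>
  \<open>op_distr dx \<theta> \<tau> T v u\<close> is the pairing of \<open>Op\<^bsub>\<theta>,\<tau>\<^esub>(T)v\<close> with \<open>u\<close>, i.e. of the kernel with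
  \<open>u \<otimes> v\<close>. The pullback requires \<open>(x, y) \<mapsto> (\<theta> x + \<tau> y, x - y)\<close> to be invertible, which holds
  iff \<open>\<theta> + \<tau>\<close> is.
\<close>

definition op_distr ::
    "'v::euclidean_space measure \<Rightarrow> ('v \<Rightarrow> 'v) \<Rightarrow> ('v \<Rightarrow> 'v) \<Rightarrow>
     (('v \<times> 'v dual \<Rightarrow> complex) \<Rightarrow> complex) \<Rightarrow> ('v \<Rightarrow> complex) \<Rightarrow> ('v \<Rightarrow> complex) \<Rightarrow> complex" where
  "op_distr dx \<theta> \<tau> T v u =
     pullback_distr (\<lambda>(x, y). (\<theta> x + \<tau> y, x - y)) (partial_inv_fourier_distr dx T)
       (\<lambda>(x, y). u x * v y)"

text \<open>
  \<open>weyl_op dx dp \<theta> \<tau> (y, p) v\<close> is the distribution \<open>\<W>\<^bsub>\<theta>,\<tau>\<^esub>(y, p)v\<close>; the symbol is the plane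
  wave \<open>exp(i \<sigma>((y, p); \<cdot>))\<close>. Explicitly, it is the function
  \<open>x \<mapsto> exp(i \<langle>\<theta> x + \<tau> (x - y), p\<rangle>) v(x - y)\<close>.
\<close>

definition weyl_op ::
    "'v::euclidean_space measure \<Rightarrow> 'v dual measure \<Rightarrow> ('v \<Rightarrow> 'v) \<Rightarrow> ('v \<Rightarrow> 'v) \<Rightarrow>
     'v \<times> 'v dual \<Rightarrow> ('v \<Rightarrow> complex) \<Rightarrow> ('v \<Rightarrow> complex) \<Rightarrow> complex" where
  "weyl_op dx dp \<theta> \<tau> Y =
     op_distr dx \<theta> \<tau> (distr_of (dx \<Otimes>\<^sub>M dp) (\<lambda>X. cis (symplectic Y X)))"

end

theory Submission
  imports Defs "HOL-Probability.Sinc_Integral"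
begin

text \<open>
  Uniqueness of Haar measure gives \<open>dx = c \<cdot> lborel\<close>, and \<open>dp\<close> is \<open>c' \<cdot> lborel\<close> transported by the
  isomorphism \<open>V \<rightarrow> V\<^sup>*\<close> of the inner product, so that everything takes place on Euclidean spaces.
  Put \<open>L (x, y) = (\<theta> x + \<tau> y, x - y)\<close> and \<open>\<psi> = (u \<otimes> v) \<circ> L\<^sup>-\<^sup>1\<close>. Fourier inversion in the second
  variable of \<open>\<psi>\<close> gives \<open>w (y, p) = c \<bar>det L\<bar>\<^sup>-\<^sup>1 \<integral> cis \<langle>z, p\<rangle> \<psi> (z, y) dz\<close>, a partial Fourier transform
  of a Schwartz function, hence a Schwartz function. Likewise \<open>F\<^sub>\<sigma> a (y, p)\<close> is the Fourier transform in
  \<open>z\<close> of \<open>H (z, y) = \<integral> cis \<langle>y, k\<rangle> a (z, k) dk\<close>. By Fubini and Fourier inversion in \<open>z\<close>, the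
  right-hand side is a multiple of \<open>\<integral> \<psi> H\<close>, which the change of variables \<open>L\<close> turns into the pairing
  of \<open>Op(a) v\<close> with \<open>u\<close>.
\<close>

section \<open>Schwartz functions\<close>

text \<open>The inversion formula enters through the condition that normalises \<open>dp\<close>; it
  only has to be moved to coordinates, where the factors of the two measures merge with the power of
  2 pi into one constant \<open>K\<close>. The analytic burden is the stability of the Schwartz
  class: that \<open>w\<close> is Schwartz, and that the oscillating integrals around it may be
  reordered, rests on the partial Fourier transform being Schwartz jointly in frequency and
  parameter. Iterated derivatives are never estimated directly. Differentiating the transform, or
  multiplying it by a coordinate, yields the transform of another Schwartz function, and such
  one-step closure suffices. A further obstacle is that \<open>\<theta>\<close> and
  \<open>\<tau>\<close> may each be singular: only the combined map \<open>L\<close> is invertible.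
  Hence \<open>L\<close> is applied to the test function, where its inverse preserves the Schwartz
  class, while in the pairing of the operator the decay is taken from \<open>u\<close> and
  \<open>v\<close> and the symbol contributes merely uniform bounds.\<close>

definition rapid :: "('e::real_normed_vector \<Rightarrow> complex) \<Rightarrow> bool" where
  "rapid f \<longleftrightarrow> (\<forall>k::nat. \<exists>C. \<forall>x. (1 + norm x) ^ k * norm (f x) \<le> C)"

lemma one_plus_power_le: "(1 + r) ^ k \<le> 2 ^ k * (1 + r ^ k)" if "0 \<le> r" for r :: real
proof -
  have "(1 + r) ^ k \<le> (2 * max 1 r) ^ k" using that by (intro power_mono) auto
  also have "\<dots> = 2 ^ k * (max 1 r) ^ k" by (simp add: power_mult_distrib)
  also have "\<dots> \<le> 2 ^ k * (1 + r ^ k)" using that by (auto simp: max_def)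
  finally show ?thesis .
qed

text \<open>Links the seminorms in \<open>schwartz\<close> with a weight that is at least 1: powers
  of \<open>1 + norm x\<close> grow with the exponent and also control \<open>f\<close> near 0, so
  one constant serves where the powers of \<open>norm x\<close> would need two.\<close>

lemma rapid_iff: "rapid f \<longleftrightarrow> (\<forall>k::nat. \<exists>C. \<forall>x. norm x ^ k * norm (f x) \<le> C)"
proof
  assume "rapid f"
  show "\<forall>k::nat. \<exists>C. \<forall>x. norm x ^ k * norm (f x) \<le> C"
  proof
    fix k
    from \<open>rapid f\<close> obtain C where C: "\<And>x. (1 + norm x) ^ k * norm (f x) \<le> C"
      unfolding rapid_def by metis
    have "norm x ^ k * norm (f x) \<le> C" for x
      by (rule order_trans[OF _ C[of x]]) (intro mult_right_mono power_mono, auto)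
    thus "\<exists>C. \<forall>x. norm x ^ k * norm (f x) \<le> C" by blast
  qed
next
  assume *: "\<forall>k::nat. \<exists>C. \<forall>x. norm x ^ k * norm (f x) \<le> C"
  show "rapid f" unfolding rapid_def
  proof
    fix k
    obtain C where C: "\<And>x. norm x ^ k * norm (f x) \<le> C" using * by metis
    obtain C0 where C0: "\<And>x. norm x ^ 0 * norm (f x) \<le> C0" using * by metis
    have "(1 + norm x) ^ k * norm (f x) \<le> 2 ^ k * (C0 + C)" for x
    proof -
      have "(1 + norm x) ^ k * norm (f x) \<le> (2 ^ k * (1 + norm x ^ k)) * norm (f x)"
        by (intro mult_right_mono one_plus_power_le) auto
      also have "\<dots> = 2 ^ k * (norm x ^ 0 * norm (f x) + norm x ^ k * norm (f x))"
        by (simp add: algebra_simps)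
      also have "\<dots> \<le> 2 ^ k * (C0 + C)"
        by (intro mult_left_mono add_mono C C0) auto
      finally show ?thesis .
    qed
    thus "\<exists>C. \<forall>x. (1 + norm x) ^ k * norm (f x) \<le> C" by blast
  qed
qed

lemma rapidE:
  assumes "rapid f"
  obtains C where "0 \<le> C" "\<And>x. (1 + norm x) ^ k * norm (f x) \<le> C"
proof -
  obtain C where C: "\<And>x. (1 + norm x) ^ k * norm (f x) \<le> C"
    using assms unfolding rapid_def by metis
  have "0 \<le> (1 + norm (0::'a)) ^ k * norm (f 0)" by simp
  also have "\<dots> \<le> C" by (rule C)
  finally show ?thesis using C that by blast
qed

lemma rapid_add:
  assumes "rapid f" "rapid g"
  shows "rapid (\<lambda>x. f x + g x)"
  unfolding rapid_def
proof
  fix k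
  obtain C where C: "\<And>x. (1 + norm x) ^ k * norm (f x) \<le> C" using rapidE[OF assms(1)] by metis
  obtain C' where C': "\<And>x. (1 + norm x) ^ k * norm (g x) \<le> C'" using rapidE[OF assms(2)] by metis
  have "(1 + norm x) ^ k * norm (f x + g x) \<le> C + C'" for x
  proof -
    have "(1 + norm x) ^ k * norm (f x + g x) \<le> (1 + norm x) ^ k * (norm (f x) + norm (g x))"
      by (intro mult_left_mono norm_triangle_ineq) auto
    also have "\<dots> \<le> C + C'" using C[of x] C'[of x] by (simp add: algebra_simps)
    finally show ?thesis .
  qed
  thus "\<exists>C. \<forall>x. (1 + norm x) ^ k * norm (f x + g x) \<le> C" by blast
qed

lemma rapid_bounded_linear_mult:
  assumes "rapid f" "bounded_linear l"
  shows "rapid (\<lambda>x. l x * f x)"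
  unfolding rapid_def
proof
  fix k
  obtain C where C: "0 \<le> C" "\<And>x. (1 + norm x) ^ Suc k * norm (f x) \<le> C"
    using rapidE[OF assms(1)] by metis
  obtain K where K: "0 \<le> K" "\<And>x. norm (l x) \<le> norm x * K"
    using bounded_linear.nonneg_bounded[OF assms(2)] by blast
  have "(1 + norm x) ^ k * norm (l x * f x) \<le> K * C" for x
  proof -
    have "norm (l x) \<le> K * (1 + norm x)"
      using K(2)[of x] K(1) by (simp add: algebra_simps)
    hence "(1 + norm x) ^ k * norm (l x * f x) \<le> (1 + norm x) ^ k * ((K * (1 + norm x)) * norm (f x))"
      unfolding norm_mult by (intro mult_left_mono mult_right_mono) auto
    also have "\<dots> = K * ((1 + norm x) ^ Suc k * norm (f x))" by (simp add: algebra_simps)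
    also have "\<dots> \<le> K * C" by (intro mult_left_mono C K)
    finally show ?thesis .
  qed
  thus "\<exists>C. \<forall>x. (1 + norm x) ^ k * norm (l x * f x) \<le> C" by blast
qed

lemma rapid_cmult:
  assumes "rapid f"
  shows "rapid (\<lambda>x. c * f x)"
  unfolding rapid_def
proof
  fix k
  obtain C where C: "\<And>x. (1 + norm x) ^ k * norm (f x) \<le> C" using rapidE[OF assms] by metis
  have "(1 + norm x) ^ k * norm (c * f x) \<le> norm c * C" for x
    using mult_left_mono[OF C[of x] norm_ge_zero[of c]] by (simp add: norm_mult algebra_simps)
  thus "\<exists>C. \<forall>x. (1 + norm x) ^ k * norm (c * f x) \<le> C" by blast
qed

text \<open>The lower bound on \<open>L\<close> is what transfers decay: without it
  \<open>L x\<close> could stay bounded while \<open>x\<close> goes to infinity.\<close>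

lemma rapid_compose_affine:
  assumes "rapid f" and L: "\<And>x. norm x \<le> c * norm (L x)"
  shows "rapid (\<lambda>x. f (L x + b))"
  unfolding rapid_def
proof
  fix k
  obtain C where C: "0 \<le> C" "\<And>x. (1 + norm x) ^ k * norm (f x) \<le> C"
    using rapidE[OF assms(1)] by metis
  \<comment> \<open>From \<open>norm (L x) \<le> norm (L x + b) + norm b\<close>, bounded by
    \<open>(1 + norm b) * (1 + norm (L x + b))\<close>. The absolute value is there because the sign
    of \<open>c\<close> is unknown.\<close>
  define d where "d = 1 + \<bar>c\<bar> * (1 + norm b)"
  have d: "1 + norm x \<le> d * (1 + norm (L x + b))" for x
  proof -
    have "norm (L x) \<le> norm (L x + b) + norm b" by (metis add_diff_cancel norm_triangle_ineq4)
    hence "norm (L x) \<le> (1 + norm b) * (1 + norm (L x + b))"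
      using mult_nonneg_nonneg[OF norm_ge_zero[of b] norm_ge_zero[of "L x + b"]]
      unfolding ring_distribs by linarith
    hence "\<bar>c\<bar> * norm (L x) \<le> \<bar>c\<bar> * ((1 + norm b) * (1 + norm (L x + b)))"
      by (intro mult_left_mono) auto
    moreover have "norm x \<le> \<bar>c\<bar> * norm (L x)"
      by (rule order_trans[OF L]) (intro mult_right_mono, auto)
    ultimately show ?thesis
      using norm_ge_zero[of "L x + b"] unfolding d_def ring_distribs by linarith
  qed
  have "(1 + norm x) ^ k * norm (f (L x + b)) \<le> d ^ k * C" for x
  proof -
    have "(1 + norm x) ^ k * norm (f (L x + b)) \<le> (d * (1 + norm (L x + b))) ^ k * norm (f (L x + b))"
      by (intro mult_right_mono power_mono d) auto
    also have "\<dots> = d ^ k * ((1 + norm (L x + b)) ^ k * norm (f (L x + b)))"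
      by (simp add: power_mult_distrib)
    also have "\<dots> \<le> d ^ k * C" by (intro mult_left_mono C) (auto simp: d_def)
    finally show ?thesis .
  qed
  thus "\<exists>C. \<forall>x. (1 + norm x) ^ k * norm (f (L x + b)) \<le> C" by blast
qed

lemma one_plus_norm_Pair_le: "1 + norm (x, y) \<le> (1 + norm x) * (1 + norm y)"
proof -
  have "norm (x, y) \<le> norm x + norm y" by (rule norm_Pair_le)
  thus ?thesis using mult_nonneg_nonneg[OF norm_ge_zero[of x] norm_ge_zero[of y]]
    unfolding ring_distribs by linarith
qed

lemma rapid_tensor:
  assumes "rapid f" "rapid g"
  shows "rapid (\<lambda>(x, y). f x * g y)"
  unfolding rapid_def
proof
  fix k
  obtain C where C: "0 \<le> C" "\<And>x. (1 + norm x) ^ k * norm (f x) \<le> C"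
    using rapidE[OF assms(1)] by metis
  obtain C' where C': "\<And>x. (1 + norm x) ^ k * norm (g x) \<le> C'" using rapidE[OF assms(2)] by metis
  have "(1 + norm (x, y)) ^ k * norm (f x * g y) \<le> C * C'" for x y
  proof -
    have "(1 + norm (x, y)) ^ k * norm (f x * g y) \<le> ((1 + norm x) * (1 + norm y)) ^ k * norm (f x * g y)"
      by (intro mult_right_mono power_mono one_plus_norm_Pair_le) auto
    also have "\<dots> = ((1 + norm x) ^ k * norm (f x)) * ((1 + norm y) ^ k * norm (g y))"
      by (simp add: power_mult_distrib norm_mult)
    also have "\<dots> \<le> C * C'" by (intro mult_mono C C') (auto simp: C)
    finally show ?thesis .
  qed
  thus "\<exists>C. \<forall>x. (1 + norm x) ^ k * norm ((\<lambda>(x, y). f x * g y) x) \<le> C" by auto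
qed

text \<open>
  Being a Schwartz function is coinductive: it suffices to exhibit a class of differentiable rapidly
  decreasing functions that is closed under directional derivatives.
\<close>

lemma schwartz_coinduct:
  assumes "P f"
    and diff: "\<And>f x. P f \<Longrightarrow> f differentiable (at x)"
    and deriv: "\<And>f h. P f \<Longrightarrow> P (\<lambda>x. frechet_derivative f (at x) h)"
    and rapid: "\<And>f. P f \<Longrightarrow> rapid f"
  shows "schwartz f"
proof -
  have "P (dir_deriv hs f)" for hs
    by (induction hs) (auto intro: assms(1) deriv)
  thus ?thesis using diff rapid unfolding schwartz_def smooth_def rapid_iff by blast
qed

section \<open>Closure properties of the Schwartz class\<close>

lemma schwartz_differentiable: "schwartz f \<Longrightarrow> f differentiable (at x)"
  unfolding schwartz_def smooth_def by (metis dir_deriv.simps(1))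

lemma schwartz_rapid: "schwartz f \<Longrightarrow> rapid f"
  unfolding schwartz_def rapid_iff by (metis dir_deriv.simps(1))

lemma schwartz_frechet_derivative:
  assumes "schwartz f"
  shows "schwartz (\<lambda>x. frechet_derivative f (at x) h)"
proof -
  \<comment> \<open>The head of the list is the outermost derivative, so the one taken first is
    appended at the end.\<close>
  have "dir_deriv hs (\<lambda>x. frechet_derivative f (at x) h) = dir_deriv (hs @ [h]) f" for hs
    by (induction hs) auto
  thus ?thesis using assms unfolding schwartz_def smooth_def by simp
qed

lemma schwartz_has_derivative:
  "schwartz f \<Longrightarrow> (f has_derivative frechet_derivative f (at x)) (at x)"
  using schwartz_differentiable frechet_derivative_works by blast

lemma schwartz_continuous: "schwartz f \<Longrightarrow> continuous_on A f"
  by (meson continuous_at_imp_continuous_on differentiable_imp_continuous_within schwartz_differentiable)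

lemma frechet_derivative_add_fun:
  assumes "f differentiable (at x)" "g differentiable (at x)"
  shows "frechet_derivative (\<lambda>x. f x + g x) (at x) h
    = frechet_derivative f (at x) h + frechet_derivative g (at x) h"
  using frechet_derivative_at[OF has_derivative_add[OF assms[unfolded frechet_derivative_works]]]
  by metis

lemma schwartz_add:
  assumes "schwartz f" "schwartz g"
  shows "schwartz (\<lambda>x. f x + g x)"
proof (rule schwartz_coinduct[where P = "\<lambda>f. \<exists>g h. schwartz g \<and> schwartz h \<and> f = (\<lambda>x. g x + h x)"])
  show "\<exists>g' h. schwartz g' \<and> schwartz h \<and> (\<lambda>x. f x + g x) = (\<lambda>x. g' x + h x)" using assms by blast
next
  fix f :: "'a \<Rightarrow> complex" and x assume "\<exists>g h. schwartz g \<and> schwartz h \<and> f = (\<lambda>x. g x + h x)"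
  thus "f differentiable (at x)"
    by (elim exE conjE, hypsubst) (intro differentiable_add schwartz_differentiable)
next
  fix f :: "'a \<Rightarrow> complex" and d assume "\<exists>g h. schwartz g \<and> schwartz h \<and> f = (\<lambda>x. g x + h x)"
  then obtain g h where gh: "schwartz g" "schwartz h" "f = (\<lambda>x. g x + h x)" by blast
  have "(\<lambda>x. frechet_derivative f (at x) d) =
    (\<lambda>x. frechet_derivative g (at x) d + frechet_derivative h (at x) d)"
    unfolding gh(3) using gh by (simp add: frechet_derivative_add_fun schwartz_differentiable)
  thus "\<exists>g h. schwartz g \<and> schwartz h \<and> (\<lambda>x. frechet_derivative f (at x) d) = (\<lambda>x. g x + h x)"
    using gh schwartz_frechet_derivative by blast
next
  fix f :: "'a \<Rightarrow> complex" assume "\<exists>g h. schwartz g \<and> schwartz h \<and> f = (\<lambda>x. g x + h x)"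
  thus "rapid f" using rapid_add schwartz_rapid by blast
qed

lemma schwartz_cmult:
  assumes "schwartz f"
  shows "schwartz (\<lambda>x. c * f x)"
proof (rule schwartz_coinduct[where P = "\<lambda>g. \<exists>f. schwartz f \<and> g = (\<lambda>x. c * f x)"])
  show "\<exists>f'. schwartz f' \<and> (\<lambda>x. c * f x) = (\<lambda>x. c * f' x)" using assms by blast
next
  fix g :: "'a \<Rightarrow> complex" and x assume "\<exists>f. schwartz f \<and> g = (\<lambda>x. c * f x)"
  thus "g differentiable (at x)"
    by (elim exE conjE, hypsubst) (intro differentiable_mult differentiable_const schwartz_differentiable)
next
  fix g :: "'a \<Rightarrow> complex" and d assume "\<exists>f. schwartz f \<and> g = (\<lambda>x. c * f x)"
  then obtain f where f: "schwartz f" "g = (\<lambda>x. c * f x)" by blast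
  have "(g has_derivative (\<lambda>h. c * frechet_derivative f (at x) h)) (at x)" for x
    unfolding f(2) by (intro has_derivative_mult_right schwartz_has_derivative f)
  from frechet_derivative_at[OF this]
  have "(\<lambda>x. frechet_derivative g (at x) d) = (\<lambda>x. c * frechet_derivative f (at x) d)" by metis
  thus "\<exists>f. schwartz f \<and> (\<lambda>x. frechet_derivative g (at x) d) = (\<lambda>x. c * f x)"
    using f schwartz_frechet_derivative by blast
next
  fix g :: "'a \<Rightarrow> complex" assume "\<exists>f. schwartz f \<and> g = (\<lambda>x. c * f x)"
  thus "rapid g" using rapid_cmult schwartz_rapid by blast
qed

text \<open>The derivative of \<open>l * f\<close> along \<open>d\<close> is \<open>l * f'\<close>
  plus \<open>l d * f\<close>, and \<open>l d\<close> is a constant. Products alone are therefore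
  not stable, but products plus a Schwartz remainder are, and this is the coinduction
  invariant.\<close>

lemma schwartz_bounded_linear_mult:
  assumes "schwartz f" "bounded_linear l"
  shows "schwartz (\<lambda>x. l x * f x)"
proof (rule schwartz_coinduct[where
      P = "\<lambda>F. \<exists>f g. schwartz f \<and> schwartz g \<and> F = (\<lambda>x. l x * f x + g x)"])
  \<comment> \<open>The initial remainder is zero, written as a multiple of \<open>f\<close> to be
    visibly Schwartz.\<close>
  have "schwartz (\<lambda>x. 0 * f x)" by (rule schwartz_cmult) fact
  thus "\<exists>f' g. schwartz f' \<and> schwartz g \<and> (\<lambda>x. l x * f x) = (\<lambda>x. l x * f' x + g x)"
    using assms(1) by (intro exI[of _ f] exI[of _ "\<lambda>x. 0 * f x"]) auto
next
  fix F :: "'a \<Rightarrow> complex" and d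
  assume "\<exists>f g. schwartz f \<and> schwartz g \<and> F = (\<lambda>x. l x * f x + g x)"
  then obtain f g where f: "schwartz f" "schwartz g" "F = (\<lambda>x. l x * f x + g x)" by blast
  have d: "(F has_derivative (\<lambda>h. (l x * frechet_derivative f (at x) h + l h * f x)
              + frechet_derivative g (at x) h)) (at x)" for x
    unfolding f(3)
    by (intro has_derivative_add has_derivative_mult schwartz_has_derivative f
        bounded_linear_imp_has_derivative assms)
  show "F differentiable (at x)" for x using d differentiableI by blast
  from frechet_derivative_at[OF d]
  have "(\<lambda>x. frechet_derivative F (at x) d) = (\<lambda>x. l x * frechet_derivative f (at x) d
          + (l d * f x + frechet_derivative g (at x) d))" by (metis (no_types, lifting) add.assoc)
  moreover have "schwartz (\<lambda>x. l d * f x + frechet_derivative g (at x) d)"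
    by (intro schwartz_add schwartz_cmult schwartz_frechet_derivative f)
  ultimately show "\<exists>f g. schwartz f \<and> schwartz g \<and>
      (\<lambda>x. frechet_derivative F (at x) d) = (\<lambda>x. l x * f x + g x)"
    using f schwartz_frechet_derivative by blast
next
  fix F :: "'a \<Rightarrow> complex"
  assume "\<exists>f g. schwartz f \<and> schwartz g \<and> F = (\<lambda>x. l x * f x + g x)"
  thus "rapid F" using rapid_add rapid_bounded_linear_mult[OF _ assms(2)] schwartz_rapid by blast
qed

text \<open>By the chain rule the derivative along \<open>d\<close> is the derivative of
  \<open>f\<close> along the fixed vector \<open>L d\<close>, composed with the same affine map. The
  shift \<open>b\<close> covers translations and the slices of a function on a product.\<close>

lemma schwartz_compose_affine:
  assumes "schwartz f" "bounded_linear L" and L: "\<And>x. norm x \<le> c * norm (L x)"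
  shows "schwartz (\<lambda>x. f (L x + b))"
proof (rule schwartz_coinduct[where P = "\<lambda>g. \<exists>f. schwartz f \<and> g = (\<lambda>x. f (L x + b))"])
  show "\<exists>f'. schwartz f' \<and> (\<lambda>x. f (L x + b)) = (\<lambda>x. f' (L x + b))" using assms by blast
next
  fix g :: "'b \<Rightarrow> complex" and d assume "\<exists>f. schwartz f \<and> g = (\<lambda>x. f (L x + b))"
  then obtain f where f: "schwartz f" "g = (\<lambda>x. f (L x + b))" by blast
  have d: "(g has_derivative (\<lambda>h. frechet_derivative f (at (L x + b)) (L h))) (at x)" for x
    unfolding f(2)
    by (rule has_derivative_compose[OF _ schwartz_has_derivative[OF f(1)]])
      (intro has_derivative_add_const bounded_linear_imp_has_derivative assms)
  show "g differentiable (at x)" for x using d differentiableI by blast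
  from frechet_derivative_at[OF d]
  have "(\<lambda>x. frechet_derivative g (at x) d) = (\<lambda>x. (\<lambda>y. frechet_derivative f (at y) (L d)) (L x + b))"
    by metis
  thus "\<exists>f. schwartz f \<and> (\<lambda>x. frechet_derivative g (at x) d) = (\<lambda>x. f (L x + b))"
    using schwartz_frechet_derivative[OF f(1)] by blast
next
  fix g :: "'b \<Rightarrow> complex" assume "\<exists>f. schwartz f \<and> g = (\<lambda>x. f (L x + b))"
  thus "rapid g" using rapid_compose_affine[of _ c L, OF _ L] schwartz_rapid by blast
qed

lemma schwartz_compose_linear:
  assumes "schwartz f" "bounded_linear L" and L: "\<And>x. norm x \<le> c * norm (L x)"
  shows "schwartz (\<lambda>x. f (L x))"
  using schwartz_compose_affine[OF assms, of 0] by simp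

text \<open>The Leibniz rule turns a derivative of a tensor product into a sum of two tensor
  products; closing under sums gives the invariant for \<open>schwartz_tensor\<close>.\<close>

inductive tensor_span ::
  "('a::real_normed_vector \<times> 'b::real_normed_vector \<Rightarrow> complex) \<Rightarrow> bool" where
  tensor: "schwartz f \<Longrightarrow> schwartz g \<Longrightarrow> tensor_span (\<lambda>z. f (fst z) * g (snd z))"
| add: "tensor_span F \<Longrightarrow> tensor_span G \<Longrightarrow> tensor_span (\<lambda>z. F z + G z)"

lemma schwartz_tensor:
  fixes f :: "'a::real_normed_vector \<Rightarrow> complex" and g :: "'b::real_normed_vector \<Rightarrow> complex"
  assumes "schwartz f" "schwartz g"
  shows "schwartz (\<lambda>(x, y). f x * g y)"
proof (rule schwartz_coinduct[where P = tensor_span])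
  show "tensor_span (\<lambda>(x, y). f x * g y)"
    unfolding case_prod_beta by (rule tensor_span.tensor[OF assms])
  have d: "((\<lambda>z. f (fst z) * g (snd z)) has_derivative
      (\<lambda>h. f (fst z) * frechet_derivative g (at (snd z)) (snd h)
          + frechet_derivative f (at (fst z)) (fst h) * g (snd z))) (at z)"
    if "schwartz f" "schwartz g" for f :: "'a \<Rightarrow> complex" and g :: "'b \<Rightarrow> complex" and z
    by (intro has_derivative_mult has_derivative_compose[OF _ schwartz_has_derivative] that
        has_derivative_fst has_derivative_snd has_derivative_ident)
  show diff: "F differentiable (at z)" if "tensor_span F" for F :: "'a \<times> 'b \<Rightarrow> complex" and z
    using that
  proof induction
    case (tensor f g)
    show ?case by (rule differentiableI[OF d[OF tensor]])
  qed (intro differentiable_add)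
  show "tensor_span (\<lambda>z. frechet_derivative F (at z) h)"
    if "tensor_span F" for F :: "'a \<times> 'b \<Rightarrow> complex" and h
    using that
  proof induction
    case (tensor f g)
    have "(\<lambda>z. frechet_derivative (\<lambda>z. f (fst z) * g (snd z)) (at z) h) =
      (\<lambda>z. f (fst z) * frechet_derivative g (at (snd z)) (snd h)
          + frechet_derivative f (at (fst z)) (fst h) * g (snd z))"
      unfolding frechet_derivative_at[OF d[OF tensor], symmetric] ..
    moreover have "tensor_span \<dots>"
      by (intro tensor_span.add tensor_span.tensor tensor schwartz_frechet_derivative)
    ultimately show ?case by simp
  next
    case (add F G)
    have "frechet_derivative (\<lambda>z. F z + G z) (at z) h
        = frechet_derivative F (at z) h + frechet_derivative G (at z) h" for z
      by (intro frechet_derivative_add_fun diff add.hyps)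
    thus ?case using tensor_span.add[OF add.IH] by simp
  qed
  show "rapid F" if "tensor_span F" for F :: "'a \<times> 'b \<Rightarrow> complex"
    using that
  proof induction
    case (tensor f g)
    thus ?case by (intro rapid_tensor[unfolded case_prod_beta] schwartz_rapid)
  qed (rule rapid_add)
qed

section \<open>Integrability and differentiation under the integral\<close>

text \<open>An explicit integrable majorant. The exponent reserves a factor
  \<open>(1 + norm x)\<^sup>2\<close> for each coordinate.\<close>

definition decay_weight :: "'a::euclidean_space \<Rightarrow> real" where
  "decay_weight x = inverse ((1 + norm x) ^ (2 * DIM('a)))"

lemma decay_weight_pos: "0 < decay_weight x"
  by (auto simp: decay_weight_def add_pos_nonneg)

lemma decay_weight_measurable [measurable]: "decay_weight \<in> borel_measurable borel"
  unfolding decay_weight_def[abs_def] by measurable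

lemma nn_integral_inverse_1_plus_square:
  "(\<integral>\<^sup>+x. ennreal (inverse (1 + x\<^sup>2)) \<partial>(lborel :: real measure)) < \<infinity>"
proof -
  have "integrable lborel (\<lambda>x::real. inverse (1 + x\<^sup>2))"
    using integrable_inverse_1_plus_square by (simp add: set_integrable_def einterval_def)
  thus ?thesis unfolding integrable_iff_bounded by simp
qed

text \<open>Each factor \<open>(1 + norm x)\<^sup>2\<close> dominates
  \<open>1 + (x \<bullet> b)\<^sup>2\<close>, so the weight lies below a product of one-dimensional
  integrable functions, which Tonelli integrates coordinate by coordinate.\<close>

lemma integrable_decay_weight: "integrable lborel (decay_weight :: 'a::euclidean_space \<Rightarrow> real)"
proof (rule integrableI_bounded)
  have le: "decay_weight x \<le> (\<Prod>b\<in>Basis. inverse (1 + (x \<bullet> b)\<^sup>2))" for x :: 'a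
  proof -
    have "(\<Prod>b\<in>Basis. 1 + (x \<bullet> b)\<^sup>2) \<le> (\<Prod>b\<in>(Basis::'a set). (1 + norm x)\<^sup>2)"
    proof (rule prod_mono, safe)
      fix b :: 'a assume "b \<in> Basis"
      hence "\<bar>x \<bullet> b\<bar> \<le> norm x" by (rule Basis_le_norm)
      hence "(x \<bullet> b)\<^sup>2 \<le> (norm x)\<^sup>2" by (metis abs_norm_cancel abs_le_square_iff)
      thus "1 + (x \<bullet> b)\<^sup>2 \<le> (1 + norm x)\<^sup>2"
        using norm_ge_zero[of x] unfolding power2_sum power_one by linarith
    qed (auto intro: add_nonneg_nonneg)
    also have "\<dots> = (1 + norm x) ^ (2 * DIM('a))" by (simp add: power_mult)
    finally show ?thesis unfolding decay_weight_def prod_inversef[unfolded comp_def]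
      by (intro le_imp_inverse_le prod_pos) (auto intro: add_pos_nonneg)
  qed
  have "(\<integral>\<^sup>+x. ennreal (norm (decay_weight x)) \<partial>(lborel :: 'a measure))
      \<le> (\<integral>\<^sup>+x. (\<Prod>b\<in>(Basis::'a set). ennreal (inverse (1 + (x \<bullet> b)\<^sup>2))) \<partial>lborel)"
    by (intro nn_integral_mono, subst prod_ennreal)
      (auto simp: abs_of_pos[OF decay_weight_pos] intro!: ennreal_leI le)
  also have "\<dots> = (\<Prod>b\<in>(Basis::'a set). (\<integral>\<^sup>+x. ennreal (inverse (1 + x\<^sup>2)) \<partial>lborel))"
    by (rule nn_integral_lborel_prod) auto
  also have "\<dots> < \<infinity>"
    using nn_integral_inverse_1_plus_square by (simp add: power_less_top_ennreal less_top)
  finally show "(\<integral>\<^sup>+x. ennreal (norm (decay_weight x)) \<partial>(lborel :: 'a measure)) < \<infinity>" .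
qed simp

text \<open>An inequality of Peetre type: it makes the majorant of a translated Schwartz function
  uniform over bounded translations.\<close>

lemma decay_weight_translate:
  "decay_weight (x + s) \<le> (1 + norm s) ^ (2 * DIM('a)) * decay_weight x" for x s :: "'a::euclidean_space"
proof -
  have "norm x \<le> norm (x + s) + norm s" by (metis add_diff_cancel norm_triangle_ineq4)
  hence "1 + norm x \<le> (1 + norm s) * (1 + norm (x + s))"
    using mult_nonneg_nonneg[OF norm_ge_zero[of s] norm_ge_zero[of "x + s"]]
    unfolding ring_distribs by linarith
  hence "(1 + norm x) ^ (2 * DIM('a)) \<le> ((1 + norm s) * (1 + norm (x + s))) ^ (2 * DIM('a))"
    by (intro power_mono) auto
  moreover have "inverse B \<le> S * inverse A" if "A \<le> S * B" "0 < A" "0 < B" for A B S :: real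
    using that by (simp add: field_simps)
  ultimately show ?thesis
    unfolding decay_weight_def power_mult_distrib
    by (simp add: zero_less_power add_pos_nonneg)
qed

text \<open>Of \<open>2 * DIM('a) + k\<close> available powers, the first \<open>2 * DIM('a)\<close>
  pay for integrability in \<open>z\<close>, uniformly in the parameter \<open>y\<close>, and
  \<open>k\<close> are left to absorb polynomial factors.\<close>

lemma rapid_le_decay_weight:
  fixes f :: "'a::euclidean_space \<times> 'b::real_normed_vector \<Rightarrow> complex"
  assumes "rapid f"
  obtains C where "0 \<le> C" "\<And>z y. (1 + norm (z, y)) ^ k * norm (f (z, y)) \<le> C * decay_weight z"
proof -
  let ?N = "2 * DIM('a)"
  obtain C where C: "0 \<le> C" "\<And>x. (1 + norm x) ^ (?N + k) * norm (f x) \<le> C"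
    using rapidE[OF assms] by metis
  have "(1 + norm (z, y)) ^ k * norm (f (z, y)) \<le> C * decay_weight z" for z y
  proof -
    have "norm z \<le> norm (z, y)" by (rule norm_fst_le)
    hence "(1 + norm z) ^ ?N * ((1 + norm (z, y)) ^ k * norm (f (z, y)))
      \<le> (1 + norm (z, y)) ^ ?N * ((1 + norm (z, y)) ^ k * norm (f (z, y)))"
      by (intro mult_right_mono power_mono) auto
    also have "\<dots> \<le> C" using C(2)[of "(z, y)"] by (simp add: power_add mult.assoc)
    finally show ?thesis unfolding decay_weight_def
      by (subst divide_inverse[symmetric], subst pos_le_divide_eq)
        (auto simp: mult_ac intro!: zero_less_power add_pos_nonneg)
  qed
  with C(1) show ?thesis using that by blast
qed

lemma schwartz_borel_measurable:
  "schwartz f \<Longrightarrow> f \<in> borel_measurable borel"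
  using schwartz_continuous by (intro borel_measurable_continuous_onI) blast

lemma schwartz_le_decay_weight:
  fixes f :: "'a::euclidean_space \<Rightarrow> complex"
  assumes "schwartz f"
  obtains C where "0 \<le> C" "\<And>x. norm (f x) \<le> C * decay_weight x"
proof -
  let ?N = "2 * DIM('a)"
  obtain C where C: "0 \<le> C" "\<And>x. (1 + norm x) ^ ?N * norm (f x) \<le> C"
    using rapidE[OF schwartz_rapid[OF assms]] by metis
  have "norm (f x) \<le> C * decay_weight x" for x
    unfolding decay_weight_def
    by (subst divide_inverse[symmetric], subst pos_le_divide_eq)
      (use C(2)[of x] in \<open>auto simp: mult_ac intro!: zero_less_power add_pos_nonneg\<close>)
  with C(1) show ?thesis using that by blast
qed

lemma schwartz_integrable:
  fixes f :: "'a::euclidean_space \<Rightarrow> complex"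
  assumes "schwartz f"
  shows "integrable lborel f"
proof -
  obtain C where C: "\<And>x. norm (f x) \<le> C * decay_weight x"
    using schwartz_le_decay_weight[OF assms] by metis
  hence "norm (f x) \<le> norm (C * decay_weight x)" for x
    unfolding real_norm_def by (rule order_trans[OF _ abs_ge_self])
  thus ?thesis
    using assms
    by (intro Bochner_Integration.integrable_bound[OF integrable_mult_right[OF integrable_decay_weight]])
      (auto intro: schwartz_borel_measurable)
qed

lemma schwartz_bounded:
  assumes "schwartz f"
  obtains C where "\<And>x. norm (f x) \<le> C"
  using rapidE[OF schwartz_rapid[OF assms], of 0] by auto

text \<open>Dominated convergence for the remainder quotients \<open>?q\<close>: they tend to 0
  pointwise, and the mean value inequality on the convex set \<open>S\<close> bounds them by a
  multiple of \<open>K\<close>.\<close>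

lemma has_derivative_integral_dominated:
  fixes f :: "'x::real_normed_vector \<Rightarrow> 'z \<Rightarrow> complex"
  assumes S: "open S" "convex S" "x \<in> S"
    and der: "\<And>x z. x \<in> S \<Longrightarrow> ((\<lambda>x. f x z) has_derivative f' x z) (at x)"
    and int: "\<And>x. x \<in> S \<Longrightarrow> integrable M (f x)"
    and meas: "\<And>x h. x \<in> S \<Longrightarrow> (\<lambda>z. f' x z h) \<in> borel_measurable M"
    and bound: "\<And>x z h. x \<in> S \<Longrightarrow> norm (f' x z h) \<le> K z * norm h"
    and K: "integrable M K" "\<And>z. 0 \<le> K z"
  shows "((\<lambda>x. \<integral>z. f x z \<partial>M) has_derivative (\<lambda>h. \<integral>z. f' x z h \<partial>M)) (at x)"
proof -
  have int': "integrable M (\<lambda>z. f' x z h)" for h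
  proof (rule Bochner_Integration.integrable_bound)
    show "integrable M (\<lambda>z. K z * norm h)" using K by simp
  qed (use meas S bound K in auto)
  have lin: "linear (f' x z)" for z using der[OF S(3)] has_derivative_linear by blast
  show ?thesis unfolding has_derivative_iff_norm
  proof
    show "bounded_linear (\<lambda>h. \<integral>z. f' x z h \<partial>M)"
    proof (rule bounded_linear_intro)
      show "(\<integral>z. f' x z (h + k) \<partial>M) = (\<integral>z. f' x z h \<partial>M) + (\<integral>z. f' x z k \<partial>M)" for h k
        by (simp add: linear_add[OF lin] int')
      show "(\<integral>z. f' x z (r *\<^sub>R h) \<partial>M) = r *\<^sub>R (\<integral>z. f' x z h \<partial>M)" for r h
        by (simp add: linear_scale[OF lin] int' del: scaleR_conv_of_real)
      show "norm (\<integral>z. f' x z h \<partial>M) \<le> norm h * (\<integral>z. K z \<partial>M)" for h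
      proof -
        have "norm (\<integral>z. f' x z h \<partial>M) \<le> (\<integral>z. norm (f' x z h) \<partial>M)"
          by (rule integral_norm_bound)
        also have "\<dots> \<le> (\<integral>z. norm h * K z \<partial>M)"
          by (intro integral_mono integrable_norm int' integrable_mult_right K)
            (use bound[OF S(3)] in \<open>simp add: mult.commute\<close>)
        also have "\<dots> = norm h * (\<integral>z. K z \<partial>M)" by simp
        finally show ?thesis .
      qed
    qed
    let ?q = "\<lambda>y z. (f y z - f x z - f' x z (y - x)) /\<^sub>R norm (y - x)"
    have norm_quot: "norm (w /\<^sub>R norm d) = norm w / norm d" for w :: complex and d :: 'x
      by (simp add: divide_inverse mult.commute)
    have lip: "norm (f y z - f x z) \<le> K z * norm (y - x)" if "y \<in> S" for y z
    proof (rule differentiable_bound[OF S(2) _ _ that S(3)])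
      show "((\<lambda>x. f x z) has_derivative f' u z) (at u within S)" if "u \<in> S" for u
        using der[OF that] has_derivative_at_withinI by blast
      show "onorm (f' u z) \<le> K z" if "u \<in> S" for u
        by (intro onorm_bound K bound that)
    qed
    \<comment> \<open>One \<open>K z\<close> comes from the increment of \<open>f\<close>, the other
      from its linear part.\<close>
    have qb: "norm (?q y z) \<le> 2 * K z" if "y \<in> S" "y \<noteq> x" for y z
    proof -
      have "norm (f y z - f x z - f' x z (y - x)) \<le> norm (f y z - f x z) + norm (f' x z (y - x))"
        by (rule norm_triangle_ineq4)
      also have "\<dots> \<le> K z * norm (y - x) + K z * norm (y - x)"
        by (intro add_mono lip bound that S)
      finally have "norm (f y z - f x z - f' x z (y - x)) / norm (y - x) \<le> 2 * K z"
        using that by (subst pos_divide_le_eq) (auto simp: mult_ac)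
      thus ?thesis unfolding norm_quot .
    qed
    have "((\<lambda>y. \<integral>z. ?q y z \<partial>M) \<longlongrightarrow> (\<integral>z. 0 \<partial>M)) (at x)"
      unfolding tendsto_at_iff_sequentially
    proof (intro allI impI)
      fix X assume X: "\<forall>i. X i \<in> UNIV - {x}" "X \<longlonglongrightarrow> x"
      \<comment> \<open>Dominated convergence is applied to sequences, and the bounds hold only
        inside \<open>S\<close>; the sequence is therefore shifted past its first \<open>n0\<close>
        terms.\<close>
      obtain n0 where n0: "\<And>n. n \<ge> n0 \<Longrightarrow> X n \<in> S"
        using topological_tendstoD[OF X(2) S(1,3)] by (auto simp: eventually_sequentially)
      have "(\<lambda>n. \<integral>z. ?q (X (n + n0)) z \<partial>M) \<longlonglongrightarrow> (\<integral>z. 0 \<partial>M)"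
      proof (rule integral_dominated_convergence[where w = "\<lambda>z. 2 * K z"])
        show "(\<lambda>z. ?q (X (n + n0)) z) \<in> borel_measurable M" for n
          by (intro borel_measurable_scaleR borel_measurable_diff borel_measurable_const
              borel_measurable_integrable int int' n0 S) simp
        show "AE z in M. (\<lambda>n. ?q (X (n + n0)) z) \<longlonglongrightarrow> 0"
        proof (rule AE_I2)
          fix z
          have "((\<lambda>y. ?q y z) \<longlongrightarrow> 0) (at x)"
            by (rule tendsto_norm_zero_cancel)
              (use der[OF S(3), of z] in \<open>simp only: has_derivative_iff_norm norm_quot\<close>)
          hence "(\<lambda>n. ?q (X n) z) \<longlonglongrightarrow> 0"
            using X unfolding tendsto_at_iff_sequentially comp_def by blast
          thus "(\<lambda>n. ?q (X (n + n0)) z) \<longlonglongrightarrow> 0" by (rule LIMSEQ_ignore_initial_segment)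
        qed
        show "AE z in M. norm (?q (X (n + n0)) z) \<le> 2 * K z" for n
          using X by (intro AE_I2 qb n0) auto
        show "integrable M (\<lambda>z. 2 * K z)" using K by simp
      qed simp
      thus "((\<lambda>y. \<integral>z. ?q y z \<partial>M) \<circ> X) \<longlonglongrightarrow> (\<integral>z. 0 \<partial>M)"
        unfolding comp_def by (rule LIMSEQ_offset)
    qed
    hence lim: "((\<lambda>y. norm (\<integral>z. ?q y z \<partial>M)) \<longlongrightarrow> 0) (at x)"
      unfolding Bochner_Integration.integral_zero by (rule tendsto_norm_zero)
    have eq: "norm (\<integral>z. ?q y z \<partial>M) =
        norm ((\<integral>z. f y z \<partial>M) - (\<integral>z. f x z \<partial>M) - (\<integral>z. f' x z (y - x) \<partial>M)) / norm (y - x)"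
      if "y \<in> S" for y
    proof -
      have "(\<integral>z. ?q y z \<partial>M) = ((\<integral>z. f y z \<partial>M) - (\<integral>z. f x z \<partial>M)
          - (\<integral>z. f' x z (y - x) \<partial>M)) /\<^sub>R norm (y - x)"
        unfolding integral_scaleR_right
        by (subst Bochner_Integration.integral_diff, intro Bochner_Integration.integrable_diff int int' that S,
            rule int', subst Bochner_Integration.integral_diff) (auto intro: int that S)
      thus ?thesis by (simp only: norm_quot)
    qed
    have "\<forall>\<^sub>F y in at x. y \<in> S" using S by (simp add: eventually_at_in_open')
    hence "\<forall>\<^sub>F y in at x. norm (\<integral>z. ?q y z \<partial>M) =
        norm ((\<integral>z. f y z \<partial>M) - (\<integral>z. f x z \<partial>M) - (\<integral>z. f' x z (y - x) \<partial>M)) / norm (y - x)"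
      by (rule eventually_mono) (rule eq)
    with lim show "((\<lambda>y. norm ((\<integral>z. f y z \<partial>M) - (\<integral>z. f x z \<partial>M) - (\<integral>z. f' x z (y - x) \<partial>M))
        / norm (y - x)) \<longlongrightarrow> 0) (at x)"
      by (rule Lim_transform_eventually)
  qed
qed

section \<open>The partial Fourier transform\<close>

lemma schwartz_section_fst:
  assumes "schwartz f"
  shows "schwartz (\<lambda>z. f (z, y))"
proof -
  have "schwartz (\<lambda>z. f ((z, 0) + (0, y)))"
    by (rule schwartz_compose_affine[OF assms, where c = 1])
      (auto intro: bounded_linear_Pair bounded_linear_ident bounded_linear_zero)
  thus ?thesis by simp
qed

lemma schwartz_section_snd:
  assumes "schwartz f"
  shows "schwartz (\<lambda>y. f (z, y))"
proof -
  have "schwartz (\<lambda>y. f ((0, y) + (z, 0)))"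
    by (rule schwartz_compose_affine[OF assms, where c = 1])
      (auto intro: bounded_linear_Pair bounded_linear_ident bounded_linear_zero)
  thus ?thesis by simp
qed

text \<open>Decay is known for one direction at a time. Expanding \<open>h\<close> in the basis
  gives a bound linear in \<open>norm h\<close>, the form that domination requires.\<close>

lemma frechet_derivative_schwartz_bound:
  fixes f :: "'a::euclidean_space \<Rightarrow> complex"
  assumes "schwartz f"
  shows "norm (frechet_derivative f (at x) h) \<le> norm h * (\<Sum>b\<in>Basis. norm (frechet_derivative f (at x) b))"
proof -
  have lin: "linear (frechet_derivative f (at x))"
    using schwartz_has_derivative[OF assms] has_derivative_linear by blast
  have "frechet_derivative f (at x) h = frechet_derivative f (at x) (\<Sum>b\<in>Basis. (h \<bullet> b) *\<^sub>R b)"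
    by (simp only: euclidean_representation)
  also have "\<dots> = (\<Sum>b\<in>Basis. (h \<bullet> b) *\<^sub>R frechet_derivative f (at x) b)"
    by (simp only: linear_sum[OF lin] linear_scale[OF lin])
  also have "norm \<dots> \<le> (\<Sum>b\<in>Basis. norm h * norm (frechet_derivative f (at x) b))"
    by (rule sum_norm_le) (auto simp: Basis_le_norm intro!: mult_right_mono)
  finally show ?thesis by (simp add: sum_distrib_left)
qed

lemma integrable_cis_mult:
  fixes f :: "'a::euclidean_space \<Rightarrow> complex"
  assumes "integrable lborel f" "c \<in> borel_measurable borel"
  shows "integrable lborel (\<lambda>z. cis (c z) * f z)"
proof (rule Bochner_Integration.integrable_bound[OF assms(1)])
  show "(\<lambda>z. cis (c z) * f z) \<in> borel_measurable lborel"
    using assms by (simp add: cis_conv_exp)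
qed (simp add: norm_mult)

lemma integral_lborel_translate:
  fixes f :: "'a::euclidean_space \<Rightarrow> complex"
  assumes "f \<in> borel_measurable borel"
  shows "(\<integral>z. f (z + s) \<partial>lborel) = (\<integral>z. f z \<partial>lborel)"
proof -
  have "(\<integral>z. f z \<partial>lborel) = (\<integral>z. f z \<partial>distr lborel borel ((+) s))"
    by (simp add: lborel_distr_plus)
  also have "\<dots> = (\<integral>z. f (s + z) \<partial>lborel)"
    using assms by (intro integral_distr) auto
  finally show ?thesis by (simp add: add.commute)
qed

text \<open>
  Translation invariance evaluates \<open>\<integral> cis (z \<bullet> p) * g (z + t *\<^sub>R e)\<close> in closed form; the formula is
  its derivative at \<open>t = 0\<close>.
\<close>

lemma fourier_frechet_derivative:
  fixes g :: "'a::euclidean_space \<Rightarrow> complex"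
  assumes g: "schwartz g"
  shows "(\<integral>z. cis (z \<bullet> p) * frechet_derivative g (at z) e \<partial>lborel)
    = - \<i> * of_real (p \<bullet> e) * (\<integral>z. cis (z \<bullet> p) * g z \<partial>lborel)"
proof -
  let ?I = "\<integral>z. cis (z \<bullet> p) * g z \<partial>lborel"
  have gt: "schwartz (\<lambda>z. g (z + s))" for s
    by (rule schwartz_compose_affine[OF g bounded_linear_ident, of 1]) simp
  obtain C where C: "0 \<le> C" "\<And>z. norm (frechet_derivative g (at z) e) \<le> C * decay_weight z"
    using schwartz_le_decay_weight[OF schwartz_frechet_derivative[OF g]] by metis
  \<comment> \<open>A shift by \<open>t *\<^sub>R e\<close> with \<open>\<bar>t\<bar> < 1\<close>
    costs at most the factor \<open>(1 + norm e) ^ (2 * DIM('a))\<close>.\<close>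
  define K where "K = (\<lambda>z::'a. C * ((1 + norm e) ^ (2 * DIM('a)) * decay_weight z))"
  have dg: "((\<lambda>t. cis (z \<bullet> p) * g (z + t *\<^sub>R e)) has_derivative
      (\<lambda>h. cis (z \<bullet> p) * (h *\<^sub>R frechet_derivative g (at (z + t *\<^sub>R e)) e))) (at t)" for z t
  proof (rule has_derivative_mult_right)
    have "((\<lambda>t. g (z + t *\<^sub>R e)) has_derivative
      (\<lambda>h. frechet_derivative g (at (z + t *\<^sub>R e)) (h *\<^sub>R e))) (at t)"
      by (rule has_derivative_compose[OF _ schwartz_has_derivative[OF g]])
        (auto intro!: derivative_eq_intros)
    thus "((\<lambda>t. g (z + t *\<^sub>R e)) has_derivative
      (\<lambda>h. h *\<^sub>R frechet_derivative g (at (z + t *\<^sub>R e)) e)) (at t)"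
      using linear_scale[OF has_derivative_linear[OF schwartz_has_derivative[OF g]]] by simp
  qed
  have "((\<lambda>t. \<integral>z. cis (z \<bullet> p) * g (z + t *\<^sub>R e) \<partial>lborel) has_derivative
      (\<lambda>h. \<integral>z. cis (z \<bullet> p) * (h *\<^sub>R frechet_derivative g (at (z + 0 *\<^sub>R e)) e) \<partial>lborel)) (at 0)"
  proof (rule has_derivative_integral_dominated[where S = "ball 0 1" and K = K])
    show "integrable lborel (\<lambda>z. cis (z \<bullet> p) * g (z + t *\<^sub>R e))" for t
      by (intro integrable_cis_mult schwartz_integrable gt) auto
    show "(\<lambda>z. cis (z \<bullet> p) * (h *\<^sub>R frechet_derivative g (at (z + t *\<^sub>R e)) e)) \<in> borel_measurable lborel" for t h
      using schwartz_borel_measurable[OF schwartz_compose_affine[OF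
          schwartz_frechet_derivative[OF g, of e] bounded_linear_ident, of 1 "t *\<^sub>R e"]]
      by (simp add: cis_conv_exp)
    show "norm (cis (z \<bullet> p) * (h *\<^sub>R frechet_derivative g (at (z + t *\<^sub>R e)) e)) \<le> K z * norm h"
      if "t \<in> ball 0 1" for t z h
    proof -
      have "norm (frechet_derivative g (at (z + t *\<^sub>R e)) e) \<le> C * decay_weight (z + t *\<^sub>R e)"
        by (rule C)
      also have "\<dots> \<le> C * ((1 + norm (t *\<^sub>R e)) ^ (2 * DIM('a)) * decay_weight z)"
        by (intro mult_left_mono decay_weight_translate C)
      also have "\<dots> \<le> K z" unfolding K_def
        using that mult_left_le_one_le[of "norm e" "\<bar>t\<bar>"]
        by (intro mult_left_mono mult_right_mono power_mono add_left_mono C less_imp_le[OF decay_weight_pos])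
          (auto simp: dist_norm)
      finally have "norm h * norm (frechet_derivative g (at (z + t *\<^sub>R e)) e) \<le> norm h * K z"
        by (intro mult_left_mono) auto
      thus ?thesis by (simp add: norm_mult mult.commute)
    qed
    show "integrable lborel K" unfolding K_def
      by (intro integrable_mult_right integrable_decay_weight)
    show "0 \<le> K z" for z
      unfolding K_def by (intro mult_nonneg_nonneg C less_imp_le[OF decay_weight_pos]) auto
  qed (use dg in auto)
  moreover have "(\<integral>z. cis (z \<bullet> p) * g (z + t *\<^sub>R e) \<partial>lborel) = cis (- (t * (p \<bullet> e))) * ?I" for t
  proof -
    have "(\<integral>z. cis (z \<bullet> p) * g (z + t *\<^sub>R e) \<partial>lborel)
      = (\<integral>z. cis (- (t * (p \<bullet> e))) * (cis ((z + t *\<^sub>R e) \<bullet> p) * g (z + t *\<^sub>R e)) \<partial>lborel)"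
      by (simp add: cis_mult mult.assoc[symmetric] inner_add_left inner_commute[of e p])
    also have "\<dots> = cis (- (t * (p \<bullet> e))) * (\<integral>z. cis ((z + t *\<^sub>R e) \<bullet> p) * g (z + t *\<^sub>R e) \<partial>lborel)"
      by simp
    also have "(\<integral>z. cis ((z + t *\<^sub>R e) \<bullet> p) * g (z + t *\<^sub>R e) \<partial>lborel) = ?I"
      using schwartz_borel_measurable[OF g]
      by (intro integral_lborel_translate[where f = "\<lambda>z. cis (z \<bullet> p) * g z"]) (simp add: cis_conv_exp)
    finally show ?thesis .
  qed
  ultimately have 1: "((\<lambda>t. cis (- (t * (p \<bullet> e))) * ?I) has_derivative
      (\<lambda>h. \<integral>z. cis (z \<bullet> p) * (h *\<^sub>R frechet_derivative g (at z) e) \<partial>lborel)) (at 0)"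
    by simp
  have 2: "((\<lambda>t. cis (- (t * (p \<bullet> e))) * ?I) has_derivative
      (\<lambda>h. - \<i> * of_real (h * (p \<bullet> e)) * ?I)) (at 0)"
    by (auto intro!: derivative_eq_intros simp: scaleR_conv_of_real mult_ac)
  from fun_cong[OF has_derivative_unique[OF 1 2], of 1] show ?thesis by simp
qed

text \<open>Unnormalised, with the sign of the phase that occurs in \<open>w\<close>; the opposite
  sign is reached by negating the frequency, and transforms in the second variable by swapping
  arguments.\<close>

definition partial_fourier ::
    "('a::euclidean_space \<times> 'b::euclidean_space \<Rightarrow> complex) \<Rightarrow> 'a \<times> 'b \<Rightarrow> complex" where
  "partial_fourier f X = (\<integral>z. cis (z \<bullet> fst X) * f (z, snd X) \<partial>lborel)"

section \<open>Linearity, decay and smoothness of the partial transform\<close>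

lemma partial_fourier_integrable:
  assumes "schwartz f"
  shows "integrable lborel (\<lambda>z. cis (z \<bullet> p) * f (z, y))"
  by (intro integrable_cis_mult schwartz_integrable schwartz_section_fst assms) simp

lemma partial_fourier_add:
  assumes "schwartz f" "schwartz g"
  shows "partial_fourier (\<lambda>X. f X + g X) X = partial_fourier f X + partial_fourier g X"
  unfolding partial_fourier_def
  by (simp add: distrib_left partial_fourier_integrable assms)

lemma partial_fourier_cmult: "partial_fourier (\<lambda>X. c * f X) X = c * partial_fourier f X"
  unfolding partial_fourier_def by (simp add: mult.left_commute[of _ c])

lemma partial_fourier_bounded:
  fixes f :: "'a::euclidean_space \<times> 'b::euclidean_space \<Rightarrow> complex"
  assumes "schwartz f"
  obtains C where "\<And>X. norm (partial_fourier f X) \<le> C"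
proof -
  obtain C where "\<And>z y. (1 + norm (z, y)) ^ 0 * norm (f (z, y)) \<le> C * decay_weight z"
    using rapid_le_decay_weight[OF schwartz_rapid[OF assms]] by metis
  hence C: "norm (f (z, y)) \<le> C * decay_weight z" for z y by simp
  have "norm (partial_fourier f X) \<le> (\<integral>z. C * decay_weight z \<partial>(lborel :: 'a measure))" for X
  proof -
    have "norm (partial_fourier f X) \<le> (\<integral>z. norm (cis (z \<bullet> fst X) * f (z, snd X)) \<partial>lborel)"
      unfolding partial_fourier_def by (rule integral_norm_bound)
    also have "\<dots> \<le> (\<integral>z. C * decay_weight z \<partial>(lborel :: 'a measure))"
      by (intro integral_mono integrable_norm partial_fourier_integrable assms
          integrable_mult_right integrable_decay_weight) (simp add: norm_mult C)
    finally show ?thesis .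
  qed
  thus ?thesis using that by blast
qed

text \<open>A frequency coordinate becomes a derivative of \<open>f\<close> by
  \<open>fourier_frechet_derivative\<close>; a parameter coordinate passes under the integral and
  multiplies \<open>f\<close>.\<close>

lemma partial_fourier_mult_inner:
  assumes f: "schwartz f"
  obtains g where "schwartz g" "\<And>X. of_real (X \<bullet> B) * partial_fourier f X = partial_fourier g X"
proof -
  obtain e h where B: "B = (e, h)" by (cases B)
  \<comment> \<open>The factor \<open>\<i>\<close> cancels the \<open>- \<i>\<close> produced by
    transforming a derivative.\<close>
  let ?g1 = "\<lambda>X. \<i> * frechet_derivative f (at X) (e, 0)"
  let ?g2 = "\<lambda>X. of_real (snd X \<bullet> h) * f X"
  have s: "schwartz ?g1" "schwartz ?g2"
    by (intro schwartz_cmult schwartz_frechet_derivative schwartz_bounded_linear_mult f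
        bounded_linear_compose[OF bounded_linear_of_real]
        bounded_linear_compose[OF bounded_linear_inner_left] bounded_linear_snd)+
  have d: "frechet_derivative (\<lambda>z. f (z, y)) (at z) e = frechet_derivative f (at (z, y)) (e, 0)" for z y
  proof -
    have "((\<lambda>z. f (z, y)) has_derivative (\<lambda>d. frechet_derivative f (at (z, y)) (d, 0))) (at z)"
      by (rule has_derivative_compose[OF _ schwartz_has_derivative[OF f]])
        (auto intro!: derivative_eq_intros)
    from frechet_derivative_at[OF this] show ?thesis by metis
  qed
  have "of_real (X \<bullet> B) * partial_fourier f X = partial_fourier (\<lambda>X. ?g1 X + ?g2 X) X" for X
  proof -
    have "partial_fourier (\<lambda>X. ?g1 X + ?g2 X) X = partial_fourier ?g1 X + partial_fourier ?g2 X"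
      by (rule partial_fourier_add[OF s])
    also have "partial_fourier ?g1 X = of_real (fst X \<bullet> e) * partial_fourier f X"
      unfolding partial_fourier_cmult
      using fourier_frechet_derivative[OF schwartz_section_fst[OF f], of "fst X" "snd X" e]
      unfolding partial_fourier_def d by (simp add: mult.assoc[symmetric])
    also have "partial_fourier ?g2 X = of_real (snd X \<bullet> h) * partial_fourier f X"
      unfolding partial_fourier_def by (simp add: mult.left_commute[of _ "of_real _"])
    finally show ?thesis unfolding B by (cases X) (simp add: algebra_simps)
  qed
  with schwartz_add[OF s] show ?thesis using that by blast
qed

text \<open>Since \<open>norm X\<close> is at most the sum of the
  \<open>\<bar>X \<bullet> B\<bar>\<close>, one power of \<open>norm X\<close> can be traded for
  replacing \<open>f\<close> by the functions \<open>g B\<close>. The induction is over all Schwartz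
  \<open>f\<close> for this reason.\<close>

lemma partial_fourier_rapid:
  fixes f :: "'a::euclidean_space \<times> 'b::euclidean_space \<Rightarrow> complex"
  assumes "schwartz f"
  shows "rapid (partial_fourier f)"
  unfolding rapid_iff
proof
  fix k
  show "\<exists>C. \<forall>X. norm X ^ k * norm (partial_fourier f X) \<le> C"
    using assms
  proof (induction k arbitrary: f)
    case 0
    thus ?case using partial_fourier_bounded by (metis mult_1 power_0)
  next
    case (Suc k)
    have "\<exists>g. schwartz g \<and> (\<forall>X. of_real (X \<bullet> B) * partial_fourier f X = partial_fourier g X)" for B
      using partial_fourier_mult_inner[OF Suc.prems] by metis
    then obtain g where g: "\<And>B. schwartz (g B)"
      "\<And>B X. of_real (X \<bullet> B) * partial_fourier f X = partial_fourier (g B) X" by metis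
    obtain C where C: "\<And>B X. norm X ^ k * norm (partial_fourier (g B) X) \<le> C B"
      using Suc.IH[OF g(1)] by metis
    have "norm X ^ Suc k * norm (partial_fourier f X) \<le> (\<Sum>B\<in>Basis. C B)" for X
    proof -
      have "norm X ^ Suc k * norm (partial_fourier f X)
          = norm X * (norm X ^ k * norm (partial_fourier f X))" by simp
      also have "\<dots> \<le> (\<Sum>B\<in>Basis. \<bar>X \<bullet> B\<bar>) * (norm X ^ k * norm (partial_fourier f X))"
        by (intro mult_right_mono norm_le_l1) auto
      also have "\<dots> = (\<Sum>B\<in>Basis. norm X ^ k * norm (partial_fourier (g B) X))"
        unfolding g(2)[symmetric] norm_mult norm_of_real sum_distrib_right
        by (simp add: mult_ac)
      also have "\<dots> \<le> (\<Sum>B\<in>Basis. C B)" by (intro sum_mono C)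
      finally show ?thesis .
    qed
    thus ?case by blast
  qed
qed

text \<open>Frequency directions bring down a linear factor from the phase, parameter directions
  fall on \<open>f\<close>. Writing the result as the transform of a single function is what makes
  the class of transforms stable.\<close>

lemma partial_fourier_has_derivative:
  fixes f :: "'a::euclidean_space \<times> 'b::euclidean_space \<Rightarrow> complex"
  assumes f: "schwartz f"
  shows "(partial_fourier f has_derivative (\<lambda>H. partial_fourier (\<lambda>X. \<i> * of_real (fst X \<bullet> fst H) * f X
            + frechet_derivative f (at X) (0, snd H)) X)) (at X)"
proof -
  \<comment> \<open>The spare power absorbs the factor \<open>z \<bullet> fst H\<close>; the
    derivative terms below need none.\<close>
  obtain C0 where C0: "0 \<le> C0" "\<And>z y. (1 + norm (z, y)) ^ 1 * norm (f (z, y)) \<le> C0 * decay_weight z"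
    using rapid_le_decay_weight[OF schwartz_rapid[OF f], of 1] by metis
  have "\<exists>C\<ge>0. \<forall>z y. (1 + norm (z, y)) ^ 0 * norm (frechet_derivative f (at (z, y)) B) \<le> C * decay_weight z" for B
    using rapid_le_decay_weight[OF schwartz_rapid[OF schwartz_frechet_derivative[OF f, of B]], of 0] by metis
  then obtain C where C: "\<And>B. 0 \<le> C B"
    "\<And>B z y. norm (frechet_derivative f (at (z, y)) B) \<le> C B * decay_weight z"
    by (metis mult_1 power_0)
  define D where "D = C0 + (\<Sum>B\<in>Basis. C B)"
  have D: "0 \<le> D" unfolding D_def by (intro add_nonneg_nonneg sum_nonneg C C0)
  let ?d = "\<lambda>X z H. cis (z \<bullet> fst X) * (\<i> * of_real (z \<bullet> fst H) * f (z, snd X)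
            + frechet_derivative f (at (z, snd X)) (0, snd H))"
  have s: "schwartz (\<lambda>X. \<i> * of_real (fst X \<bullet> fst H) * f X + frechet_derivative f (at X) (0, snd H))"
    for H :: "'a \<times> 'b"
    by (intro schwartz_add schwartz_frechet_derivative schwartz_bounded_linear_mult f
        bounded_linear_const_mult bounded_linear_compose[OF bounded_linear_of_real]
        bounded_linear_compose[OF bounded_linear_inner_left] bounded_linear_fst)
  have "((\<lambda>X. \<integral>z. cis (z \<bullet> fst X) * f (z, snd X) \<partial>lborel) has_derivative
      (\<lambda>H. \<integral>z. ?d X z H \<partial>lborel)) (at X)"
  proof (rule has_derivative_integral_dominated[where S = UNIV and K = "\<lambda>z. D * decay_weight z"])
    fix X H :: "'a \<times> 'b" and z :: 'a
    show "integrable lborel (\<lambda>z. cis (z \<bullet> fst X) * f (z, snd X))"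
      by (rule partial_fourier_integrable[OF f])
    show "(\<lambda>z. ?d X z H) \<in> borel_measurable lborel"
      using partial_fourier_integrable[OF s[of H], of "fst X" "snd X"] by simp
    show "norm (?d X z H) \<le> D * decay_weight z * norm H"
    proof -
      have n: "norm z \<le> norm (z, snd X)" by (rule norm_fst_le)
      have h: "norm (0::'a, snd H) \<le> norm H"
        unfolding norm_prod_def by simp
      have "norm (?d X z H) \<le> \<bar>z \<bullet> fst H\<bar> * norm (f (z, snd X))
          + norm (frechet_derivative f (at (z, snd X)) (0, snd H))"
        unfolding norm_mult norm_cis mult_1
        by (rule order_trans[OF norm_triangle_ineq]) (simp add: norm_mult)
      also have "\<bar>z \<bullet> fst H\<bar> \<le> (1 + norm (z, snd X)) * norm H"
      proof (rule order_trans[OF Cauchy_Schwarz_ineq2])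
        show "norm z * norm (fst H) \<le> (1 + norm (z, snd X)) * norm H"
          using n norm_fst_le[of "fst H" "snd H"] by (intro mult_mono) auto
      qed
      also have "norm (frechet_derivative f (at (z, snd X)) (0, snd H))
          \<le> norm H * (\<Sum>B\<in>Basis. C B * decay_weight z)"
        by (rule order_trans[OF frechet_derivative_schwartz_bound[OF f]])
          (intro mult_mono h sum_mono C sum_nonneg, auto)
      also have "(1 + norm (z, snd X)) * norm H * norm (f (z, snd X)) + norm H * (\<Sum>B\<in>Basis. C B * decay_weight z)
          \<le> norm H * (C0 * decay_weight z) + norm H * (\<Sum>B\<in>Basis. C B * decay_weight z)"
        using mult_left_mono[OF C0(2)[of z "snd X"] norm_ge_zero[of H]] by (simp add: mult_ac)
      also have "\<dots> = D * decay_weight z * norm H"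
        unfolding D_def by (simp add: sum_distrib_right[symmetric] algebra_simps)
      finally show ?thesis by (simp add: mult_right_mono)
    qed
    show "((\<lambda>X. cis (z \<bullet> fst X) * f (z, snd X)) has_derivative ?d X z) (at X)"
    proof -
      have 1: "((\<lambda>X. cis (z \<bullet> fst X)) has_derivative
          (\<lambda>H. \<i> * of_real (z \<bullet> fst H) * cis (z \<bullet> fst X))) (at X)"
        by (auto intro!: derivative_eq_intros simp: scaleR_conv_of_real mult_ac)
      have 2: "((\<lambda>X. f (z, snd X)) has_derivative
          (\<lambda>H. frechet_derivative f (at (z, snd X)) (0, snd H))) (at X)"
        by (rule has_derivative_compose[OF _ schwartz_has_derivative[OF f]])
          (auto intro!: derivative_eq_intros)
      show ?thesis by (rule has_derivative_eq_rhs[OF has_derivative_mult[OF 1 2]])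
          (auto simp: algebra_simps)
    qed
    show "0 \<le> D * decay_weight z"
      by (intro mult_nonneg_nonneg D less_imp_le[OF decay_weight_pos])
  qed (auto intro: integrable_decay_weight)
  thus ?thesis unfolding partial_fourier_def[abs_def] by (simp add: mult.assoc)
qed

lemma schwartz_partial_fourier:
  assumes "schwartz f"
  shows "schwartz (partial_fourier f)"
\<comment> \<open>The transforms of Schwartz functions themselves form the invariant.\<close>
proof (rule schwartz_coinduct[where P = "\<lambda>F. \<exists>f. schwartz f \<and> F = partial_fourier f"])
  show "\<exists>f'. schwartz f' \<and> partial_fourier f = partial_fourier f'" using assms by blast
next
  fix F :: "'a \<times> 'b \<Rightarrow> complex" and X
  assume "\<exists>f. schwartz f \<and> F = partial_fourier f"
  thus "F differentiable (at X)" using partial_fourier_has_derivative differentiableI by blast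
next
  fix F :: "'a \<times> 'b \<Rightarrow> complex" and H
  assume "\<exists>f. schwartz f \<and> F = partial_fourier f"
  then obtain f where f: "schwartz f" "F = partial_fourier f" by blast
  let ?g = "\<lambda>X. \<i> * of_real (fst X \<bullet> fst H) * f X + frechet_derivative f (at X) (0, snd H)"
  have "(\<lambda>X. frechet_derivative F (at X) H) = partial_fourier ?g"
    unfolding f(2) frechet_derivative_at[OF partial_fourier_has_derivative[OF f(1)], symmetric] ..
  moreover have "schwartz ?g"
    by (intro schwartz_add schwartz_frechet_derivative schwartz_bounded_linear_mult f
        bounded_linear_const_mult bounded_linear_compose[OF bounded_linear_of_real]
        bounded_linear_compose[OF bounded_linear_inner_left] bounded_linear_fst)
  ultimately show "\<exists>f. schwartz f \<and> (\<lambda>X. frechet_derivative F (at X) H) = partial_fourier f"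
    by blast
next
  fix F :: "'a \<times> 'b \<Rightarrow> complex"
  assume "\<exists>f. schwartz f \<and> F = partial_fourier f"
  thus "rapid F" using partial_fourier_rapid by blast
qed

section \<open>Lebesgue measures in coordinates\<close>

lemma lebesgue_measure_sets: "lebesgue_measure M \<Longrightarrow> sets M = sets borel"
  by (simp add: lebesgue_measure_def)

lemma lebesgue_measure_sigma_finite:
  assumes "lebesgue_measure M"
  shows "sigma_finite_measure M"
proof
  have s: "sets M = sets borel" by (rule lebesgue_measure_sets) fact
  let ?A = "range (\<lambda>n::nat. ball 0 (real n))"
  have "emeasure M (ball 0 (real n)) < \<infinity>" for n
    using assms unfolding lebesgue_measure_def by simp
  hence "emeasure M (ball 0 (real n)) \<noteq> \<infinity>" for n by (rule less_imp_neq)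
  moreover have "\<Union>?A = UNIV"
    using reals_Archimedean2 by (auto simp: dist_norm)
  ultimately show "\<exists>A. countable A \<and> A \<subseteq> sets M \<and> \<Union>A = space M \<and> (\<forall>a\<in>A. emeasure M a \<noteq> \<infinity>)"
    using sets_eq_imp_space_eq[OF s] by (intro exI[of _ ?A]) (auto simp: s)
qed

section \<open>Uniqueness of Lebesgue measure and transport by linear isomorphisms\<close>

lemma lebesgue_measure_nn_integral_translate:
  assumes "lebesgue_measure M" "f \<in> borel_measurable borel"
  shows "(\<integral>\<^sup>+x. f (z + x) \<partial>M) = (\<integral>\<^sup>+x. f x \<partial>M)"
proof -
  have [measurable_cong]: "sets M = sets borel" by (rule lebesgue_measure_sets) fact
  have m: "(\<lambda>x. z + x) \<in> measurable M borel"
    unfolding measurable_cong_sets[OF lebesgue_measure_sets[OF assms(1)] refl]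
    by (intro borel_measurable_continuous_onI continuous_intros)
  have "(\<integral>\<^sup>+x. f x \<partial>M) = (\<integral>\<^sup>+x. f x \<partial>distr M borel (\<lambda>x. z + x))"
    using assms(1) by (simp add: lebesgue_measure_def)
  also have "\<dots> = (\<integral>\<^sup>+x. f (z + x) \<partial>M)"
    by (rule nn_integral_distr[OF m]) (simp add: assms)
  finally show ?thesis ..
qed

lemma lebesgue_measure_lborel: "lebesgue_measure (lborel :: 'a::euclidean_space measure)"
  unfolding lebesgue_measure_def
  by (auto simp: lborel_distr_plus emeasure_bounded_finite[unfolded infinity_ennreal_def])

text \<open>
  Weil's argument: evaluating \<open>\<integral>\<integral> 1\<^sub>A (x + y) 1\<^sub>B (y) dM(x) dy\<close> in both orders, with \<open>B\<close> the unit ball,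
  gives \<open>M(A) \<lambda>(B) = \<lambda>(A) M(-B) = \<lambda>(A) M(B)\<close>.
\<close>

lemma lebesgue_measure_eq_density:
  fixes M :: "'a::euclidean_space measure"
  assumes M: "lebesgue_measure M"
  obtains c where "0 < c" "M = density lborel (\<lambda>_. ennreal c)"
proof -
  interpret M: sigma_finite_measure M by (rule lebesgue_measure_sigma_finite) fact
  interpret P: pair_sigma_finite M "lborel :: 'a measure" ..
  interpret Q: pair_sigma_finite "lborel :: 'a measure" M ..
  have sM [measurable_cong]: "sets M = sets borel" by (rule lebesgue_measure_sets) fact
  define B where "B = ball (0::'a) 1"
  have [measurable]: "B \<in> sets borel" by (simp add: B_def)
  have eq: "emeasure M A * emeasure lborel B = emeasure lborel A * emeasure M B"
    if A [measurable]: "A \<in> sets borel" for A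
  proof -
    have "emeasure M A * emeasure lborel B
        = (\<integral>\<^sup>+y. (\<integral>\<^sup>+x. indicator A x \<partial>M) * indicator B y \<partial>lborel)"
      by (simp add: nn_integral_cmult_indicator sM)
    also have "\<dots> = (\<integral>\<^sup>+y. (\<integral>\<^sup>+x. indicator A (y + x) * indicator B y \<partial>M) \<partial>lborel)"
      by (intro nn_integral_cong)
        (simp add: nn_integral_multc lebesgue_measure_nn_integral_translate[OF M, of "indicator A"])
    also have "\<dots> = (\<integral>\<^sup>+x. (\<integral>\<^sup>+y. indicator A (y + x) * indicator B y \<partial>lborel) \<partial>M)"
      by (rule P.Fubini') measurable
    also have "\<dots> = (\<integral>\<^sup>+x. (\<integral>\<^sup>+y. indicator A y * indicator B (y - x) \<partial>lborel) \<partial>M)"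
    proof (rule nn_integral_cong)
      fix x
      show "(\<integral>\<^sup>+y. indicator A (y + x) * indicator B y \<partial>lborel)
          = (\<integral>\<^sup>+y. indicator A y * indicator B (y - x) \<partial>lborel)"
        using lebesgue_measure_nn_integral_translate[OF lebesgue_measure_lborel,
            of "\<lambda>y. indicator A y * indicator B (y - x)" x]
        by (simp add: add.commute)
    qed
    also have "\<dots> = (\<integral>\<^sup>+y. (\<integral>\<^sup>+x. indicator A y * indicator B (y - x) \<partial>M) \<partial>lborel)"
      by (rule Q.Fubini') measurable
    also have "\<dots> = (\<integral>\<^sup>+y. indicator A y * emeasure M B \<partial>lborel)"
    proof (rule nn_integral_cong)
      fix y
      have "indicator B (y - x) = (indicator B (- y + x) :: ennreal)" for x
        by (simp add: B_def indicator_def norm_minus_commute)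
      hence "(\<integral>\<^sup>+x. indicator B (y - x) \<partial>M) = (\<integral>\<^sup>+x. indicator B (- y + x) \<partial>M)" by simp
      also have "\<dots> = emeasure M B"
        by (subst lebesgue_measure_nn_integral_translate[OF M]) (auto simp: sM)
      finally show "(\<integral>\<^sup>+x. indicator A y * indicator B (y - x) \<partial>M) = indicator A y * emeasure M B"
        by (simp add: nn_integral_cmult)
    qed
    also have "\<dots> = emeasure lborel A * emeasure M B"
      by (simp add: nn_integral_multc)
    finally show ?thesis .
  qed
  have bB: "bounded B" by (simp add: B_def)
  have pB: "measure lborel B > 0" unfolding B_def by (rule content_ball_pos) simp
  have MB: "emeasure M B \<noteq> \<infinity>"
    using M bB unfolding lebesgue_measure_def by (intro less_imp_neq) simp
  define c where "c = measure M B / measure lborel B"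
  have emM: "emeasure M B = ennreal (measure M B)"
    using MB by (intro emeasure_eq_ennreal_measure) simp
  have emB: "emeasure lborel B = ennreal (measure lborel B)"
    using emeasure_bounded_finite[OF bB] by (intro emeasure_eq_ennreal_measure) simp
  have M_eq: "emeasure M A = ennreal c * emeasure lborel A" if "A \<in> sets borel" for A
  proof -
    have "emeasure M A = emeasure M A * (ennreal (measure lborel B) * ennreal (1 / measure lborel B))"
      using pB by (simp add: ennreal_mult[symmetric])
    also have "\<dots> = emeasure lborel A * emeasure M B * ennreal (1 / measure lborel B)"
      using eq[OF that] by (simp add: emB mult.assoc[symmetric])
    also have "\<dots> = emeasure lborel A * (ennreal (measure M B) * ennreal (1 / measure lborel B))"
      by (simp add: emM mult.assoc)
    also have "ennreal (measure M B) * ennreal (1 / measure lborel B) = ennreal c"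
      unfolding c_def using pB by (simp add: ennreal_mult[symmetric])
    finally show ?thesis by (simp add: mult.commute)
  qed
  have "c \<noteq> 0"
    using M M_eq[of UNIV] unfolding lebesgue_measure_def by auto
  hence "0 < c" unfolding c_def using pB by (simp add: less_le)
  moreover have "M = density lborel (\<lambda>_. ennreal c)"
    by (rule measure_eqI) (auto simp: sM emeasure_density_const M_eq)
  ultimately show ?thesis using that by blast
qed

text \<open>A translation by \<open>z\<close> in the target corresponds to the translation by
  \<open>L' z\<close> in the source, and preimages of bounded sets are images under
  \<open>L'\<close>. This serves both the passage from the dual to \<open>V\<close> and the Jacobian
  of an endomorphism.\<close>

lemma lebesgue_measure_distr:
  fixes L :: "'a::real_normed_vector \<Rightarrow> 'b::real_normed_vector"
  assumes M: "lebesgue_measure M" and L: "bounded_linear L" "bounded_linear L'"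
    and inv: "\<And>x. L' (L x) = x" "\<And>y. L (L' y) = y"
  shows "lebesgue_measure (distr M borel L)"
proof -
  have sM: "sets M = sets borel" by (rule lebesgue_measure_sets) fact
  have mL: "L \<in> measurable borel borel"
    by (intro borel_measurable_continuous_onI linear_continuous_on L)
  have mM: "f \<in> measurable M borel" if "f \<in> measurable borel borel" for f :: "'a \<Rightarrow> 'c::topological_space"
    using that by (simp add: measurable_cong_sets[OF sM refl])
  have plus: "(\<lambda>x. z + x) \<in> measurable borel borel" for z :: "'c::real_normed_vector"
    by (intro borel_measurable_continuous_onI continuous_intros)
  show ?thesis unfolding lebesgue_measure_def
  proof (intro conjI allI ballI impI)
    fix z
    have "distr (distr M borel L) borel (\<lambda>x. z + x) = distr M borel (\<lambda>x. z + L x)"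
      using distr_distr[OF plus mM[OF mL]] by (simp add: comp_def)
    also have "(\<lambda>x. z + L x) = (\<lambda>x. L (L' z + x))"
      using inv by (simp add: linear_add[OF bounded_linear.linear[OF L(1)]])
    also have "distr M borel \<dots> = distr (distr M borel (\<lambda>x. L' z + x)) borel L"
      using distr_distr[OF mL mM[OF plus]] by (simp add: comp_def)
    also have "distr M borel (\<lambda>x. L' z + x) = M"
      using M by (simp add: lebesgue_measure_def)
    finally show "distr (distr M borel L) borel (\<lambda>x. z + x) = distr M borel L" .
  next
    fix A :: "'b set" assume A: "A \<in> sets borel" "bounded A"
    have "L -` A = L' ` A" using inv by (auto simp: image_iff) metis
    hence "bounded (L -` A)" using bounded_linear_image[OF A(2) L(2)] by simp
    moreover have "L -` A \<in> sets borel" using measurable_sets[OF mL A(1)] by simp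
    ultimately have "emeasure M (L -` A) < \<infinity>" using M by (simp add: lebesgue_measure_def)
    thus "emeasure (distr M borel L) A < \<infinity>"
      using sets_eq_imp_space_eq[OF sM] by (simp add: emeasure_distr[OF mM[OF mL] A(1)])
  next
    show "emeasure (distr M borel L) UNIV \<noteq> 0"
      using M sets_eq_imp_space_eq[OF sM]
      by (simp add: emeasure_distr[OF mM[OF mL]] lebesgue_measure_def)
  qed simp
qed

text \<open>Stated for arbitrary \<open>f\<close>, since for a non-measurable one both sides are 0
  by convention; the coordinate formulas can then be used as plain rewrite rules.\<close>

lemma integral_density_const:
  fixes f :: "'a \<Rightarrow> complex"
  assumes "0 < c"
  shows "(\<integral>x. f x \<partial>density M (\<lambda>_. ennreal c)) = of_real c * (\<integral>x. f x \<partial>M)"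
proof (cases "f \<in> borel_measurable M")
  case True
  thus ?thesis using assms by (subst integral_density) (auto simp: scaleR_conv_of_real)
next
  case False
  hence "\<not> integrable M f" "\<not> integrable (density M (\<lambda>_. ennreal c)) f"
    using borel_measurable_integrable by force+
  thus ?thesis by (simp add: not_integrable_integral_eq)
qed

text \<open>The measurable right inverse \<open>T'\<close> turns measurability of
  \<open>f \<circ> T\<close> back into that of \<open>f\<close>, so in the remaining case both
  integrals take the default value 0.\<close>

lemma integral_distr_bij:
  fixes f :: "'b \<Rightarrow> complex"
  assumes T: "T \<in> measurable M N" "T' \<in> measurable N M"
    and inv: "\<And>y. y \<in> space N \<Longrightarrow> T (T' y) = y"
  shows "(\<integral>y. f y \<partial>distr M N T) = (\<integral>x. f (T x) \<partial>M)"
proof (cases "f \<in> borel_measurable N")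
  case True
  thus ?thesis by (rule integral_distr[OF T(1)])
next
  case False
  have "(\<lambda>x. f (T x)) \<notin> borel_measurable M"
  proof
    assume "(\<lambda>x. f (T x)) \<in> borel_measurable M"
    hence "(\<lambda>y. f (T (T' y))) \<in> borel_measurable N" by (rule measurable_compose[OF T(2)])
    hence "f \<in> borel_measurable N" by (rule measurable_cong[THEN iffD1, rotated]) (simp add: inv)
    with False show False by contradiction
  qed
  hence "\<not> integrable M (\<lambda>x. f (T x))" "\<not> integrable (distr M N T) f"
    using borel_measurable_integrable False by force+
  thus ?thesis by (simp add: not_integrable_integral_eq)
qed

text \<open>The push-forward of Lebesgue measure by \<open>L\<close> is a multiple \<open>c\<close>
  of it by uniqueness; testing on the image of the unit ball gives
  \<open>c * abs_det L = 1\<close>.\<close>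

lemma integral_linear_bij:
  fixes L :: "'e::euclidean_space \<Rightarrow> 'e" and f :: "'e \<Rightarrow> complex"
  assumes L: "linear L" "bij L"
  shows "0 < abs_det L" "(\<integral>x. f x \<partial>lborel) = of_real (abs_det L) * (\<integral>x. f (L x) \<partial>lborel)"
proof -
  have inv: "inv L (L x) = x" "L (inv L x) = x" for x
    using L(2) by (auto simp: bij_def surj_f_inv_f)
  have lin: "bounded_linear L" "bounded_linear (inv L)"
    using L inj_linear_imp_inv_linear by (auto simp: linear_conv_bounded_linear[symmetric] bij_def)
  have m: "L \<in> measurable borel borel" "inv L \<in> measurable borel borel"
    by (intro borel_measurable_continuous_onI linear_continuous_on lin)+
  obtain c where c: "0 < c" "distr lborel borel L = density lborel (\<lambda>_. ennreal c)"
    using lebesgue_measure_eq_density[OF lebesgue_measure_distr[OF lebesgue_measure_lborel lin inv]] by metis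
  let ?B = "cball (0::'e) 1"
  have LB: "compact (L ` ?B)"
    by (intro compact_continuous_image linear_continuous_on lin compact_cball)
  have "emeasure lborel ?B = emeasure (distr lborel borel L) (L ` ?B)"
    using L(2) m LB by (subst emeasure_distr) (auto simp: bij_def inj_vimage_image_eq intro: borel_compact)
  also have "\<dots> = ennreal c * emeasure lborel (L ` ?B)"
    unfolding c(2) using LB by (subst emeasure_density_const) (auto intro: borel_compact)
  finally have "measure lborel ?B = c * measure lborel (L ` ?B)"
    using c(1) by (simp add: measure_def enn2real_mult)
  hence "c * abs_det L = measure lborel ?B / measure lborel ?B" by (simp add: abs_det_def)
  moreover have "0 < measure lborel ?B" by (rule content_cball_pos) simp
  ultimately have d: "c * abs_det L = 1" by simp
  thus "0 < abs_det L" using c(1) by (metis zero_less_mult_pos zero_less_one)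
  have "(\<integral>x. f (L x) \<partial>lborel) = (\<integral>x. f x \<partial>distr lborel borel L)"
    using m by (intro integral_distr_bij[symmetric, where T' = "inv L"]) (auto simp: inv)
  also have "\<dots> = of_real c * (\<integral>x. f x \<partial>lborel)"
    unfolding c(2) by (rule integral_density_const[OF c(1)])
  finally show "(\<integral>x. f x \<partial>lborel) = of_real (abs_det L) * (\<integral>x. f (L x) \<partial>lborel)"
    using d by (simp add: mult.assoc[symmetric] of_real_mult[symmetric] mult.commute del: of_real_mult)
qed

text \<open>The Riesz representative of \<open>p\<close>, hence the inverse of
  \<open>blinfun_inner_right\<close>.\<close>

definition dual_coord :: "'v::euclidean_space dual \<Rightarrow> 'v" where
  "dual_coord p = (\<Sum>b\<in>Basis. blinfun_apply p b *\<^sub>R b)"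

lemma dual_coord_inverse [simp]:
  "blinfun_inner_right (dual_coord p) = p" "dual_coord (blinfun_inner_right q) = q"
proof -
  show "blinfun_inner_right (dual_coord p) = p"
  proof (rule blinfun_eqI)
    fix x
    have "blinfun_apply p x = blinfun_apply p (\<Sum>b\<in>Basis. (x \<bullet> b) *\<^sub>R b)"
      by (simp only: euclidean_representation)
    thus "blinfun_apply (blinfun_inner_right (dual_coord p)) x = blinfun_apply p x"
      by (simp add: dual_coord_def inner_sum_left blinfun.sum_right blinfun.scaleR_right
          inner_commute[of x] mult.commute)
  qed
  show "dual_coord (blinfun_inner_right q) = q"
    by (simp add: dual_coord_def euclidean_representation)
qed

lemma bounded_linear_dual_coord: "bounded_linear (dual_coord :: 'v::euclidean_space dual \<Rightarrow> 'v)"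
  unfolding dual_coord_def[abs_def]
  by (intro bounded_linear_sum bounded_linear_scaleR_left[THEN bounded_linear_compose]
      blinfun.bounded_linear_left)

text \<open>\<open>lborel\<close> lives on Euclidean coordinates, so \<open>dp\<close> is pushed to
  \<open>V\<close> by \<open>dual_coord\<close>, identified there as a multiple of Lebesgue measure,
  and pulled back.\<close>

lemma lebesgue_measures_coordinates:
  fixes dx :: "'v::euclidean_space measure" and dp :: "'v dual measure"
  assumes dx: "lebesgue_measure dx" and dp: "lebesgue_measure dp"
  obtains c c' where "0 < c" "0 < c'"
    "\<And>f :: 'v \<Rightarrow> complex. (\<integral>x. f x \<partial>dx) = of_real c * (\<integral>x. f x \<partial>lborel)"
    "\<And>f :: 'v dual \<Rightarrow> complex. (\<integral>p. f p \<partial>dp) = of_real c' * (\<integral>q. f (blinfun_inner_right q) \<partial>lborel)"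
    "\<And>f :: 'v \<times> 'v dual \<Rightarrow> complex. (\<integral>X. f X \<partial>(dx \<Otimes>\<^sub>M dp))
      = of_real (c * c') * (\<integral>X. f (fst X, blinfun_inner_right (snd X)) \<partial>lborel)"
proof -
  let ?J = "blinfun_inner_right :: 'v \<Rightarrow> 'v dual"
  obtain c where c: "0 < c" "dx = density lborel (\<lambda>_. ennreal c)"
    using lebesgue_measure_eq_density[OF dx] by metis
  obtain c' where c': "0 < c'" "distr dp borel dual_coord = density lborel (\<lambda>_. ennreal c')"
    using lebesgue_measure_eq_density[OF lebesgue_measure_distr[OF dp bounded_linear_dual_coord
        bounded_linear_blinfun_inner_right dual_coord_inverse]] by metis
  have J: "?J \<in> measurable borel borel"
    by (intro borel_measurable_continuous_onI linear_continuous_on bounded_linear_blinfun_inner_right)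
  have Ji: "dual_coord \<in> measurable borel (borel :: 'v measure)"
    by (intro borel_measurable_continuous_onI linear_continuous_on bounded_linear_dual_coord)
  have sdp: "sets dp = sets borel" by (rule lebesgue_measure_sets[OF dp])
  define P where "P = density (lborel :: 'v measure) (\<lambda>_. ennreal c')"
  have JP: "?J \<in> measurable P borel" unfolding P_def using J by simp
  have dpP: "dp = distr P borel ?J"
  proof -
    have "distr P borel ?J = distr dp borel (?J \<circ> dual_coord)"
      unfolding P_def c'(2)[symmetric] using J Ji sdp
      by (intro distr_distr) (auto simp: measurable_cong_sets[OF sdp refl])
    also have "?J \<circ> dual_coord = (\<lambda>p. p)" by (simp add: comp_def)
    also have "distr dp borel (\<lambda>p. p) = dp" by (rule distr_id2[OF sdp[symmetric]])
    finally show ?thesis ..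
  qed
  show ?thesis
  proof
    show "0 < c" "0 < c'" by fact+
    show "(\<integral>x. f x \<partial>dx) = of_real c * (\<integral>x. f x \<partial>lborel)" for f :: "'v \<Rightarrow> complex"
      unfolding c(2) by (rule integral_density_const[OF c(1)])
    show "(\<integral>p. f p \<partial>dp) = of_real c' * (\<integral>q. f (?J q) \<partial>lborel)" for f :: "'v dual \<Rightarrow> complex"
    proof -
      have "(\<integral>p. f p \<partial>dp) = (\<integral>q. f (?J q) \<partial>P)"
        unfolding dpP using JP Ji by (intro integral_distr_bij[where T' = dual_coord]) (auto simp: P_def)
      thus ?thesis unfolding P_def by (simp add: integral_density_const[OF c'(1)])
    qed
    fix f :: "'v \<times> 'v dual \<Rightarrow> complex"
    let ?T = "\<lambda>(x::'v, q). (x, ?J q)"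
    have sf: "sigma_finite_measure P" "sigma_finite_measure (distr P borel ?J)"
      using lebesgue_measure_sigma_finite[OF dp] lebesgue_measure_sigma_finite[OF
          lebesgue_measure_distr[OF dp bounded_linear_dual_coord
        bounded_linear_blinfun_inner_right dual_coord_inverse]]
      unfolding P_def c'(2)[symmetric] dpP[unfolded P_def c'(2)[symmetric], symmetric] by auto
    have "dx \<Otimes>\<^sub>M dp = distr dx borel (\<lambda>x. x) \<Otimes>\<^sub>M distr P borel ?J"
      using dpP distr_id2[OF lebesgue_measure_sets[OF dx, symmetric]] by simp
    also have "\<dots> = distr (dx \<Otimes>\<^sub>M P) (borel \<Otimes>\<^sub>M borel) ?T"
      by (rule pair_measure_distr) (use JP sf in \<open>auto simp: c(2)\<close>)
    also have "dx \<Otimes>\<^sub>M P = density lborel (\<lambda>_. ennreal (c * c'))"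
      unfolding c(2) P_def
      by (subst pair_measure_density)
        (use sf c(1) c'(1) in \<open>auto simp: P_def lborel_prod lborel.sigma_finite_measure_axioms
          case_prod_beta' ennreal_mult\<close>)
    finally have eq: "dx \<Otimes>\<^sub>M dp = distr (density lborel (\<lambda>_. ennreal (c * c'))) (borel \<Otimes>\<^sub>M borel) ?T" .
    have "(\<integral>X. f X \<partial>(dx \<Otimes>\<^sub>M dp)) = (\<integral>X. f (?T X) \<partial>density lborel (\<lambda>_. ennreal (c * c')))"
      unfolding eq
    \<comment> \<open>The target keeps the product sigma-algebra belonging to the product of
      \<open>dx\<close> and \<open>dp\<close>; only on \<open>V \<times> V\<close> is it identified
      with \<open>borel\<close>.\<close>
    proof (rule integral_distr_bij[where T' = "\<lambda>(x, p). (x, dual_coord p)"])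
      have "?T \<in> measurable (borel \<Otimes>\<^sub>M borel) (borel \<Otimes>\<^sub>M borel)"
        using J by measurable
      thus "?T \<in> measurable (density lborel (\<lambda>_. ennreal (c * c'))) (borel \<Otimes>\<^sub>M borel)"
        by (simp add: borel_prod)
      have "(\<lambda>(x::'v, p). (x, dual_coord p)) \<in> measurable (borel \<Otimes>\<^sub>M borel) (borel \<Otimes>\<^sub>M (borel :: 'v measure))"
        using Ji by measurable
      thus "(\<lambda>(x, p). (x, dual_coord p))
          \<in> measurable (borel \<Otimes>\<^sub>M borel) (density (lborel :: ('v \<times> 'v) measure) (\<lambda>_. ennreal (c * c')))"
        by (simp add: borel_prod)
    qed auto
    thus "(\<integral>X. f X \<partial>(dx \<Otimes>\<^sub>M dp)) = of_real (c * c') * (\<integral>X. f (fst X, ?J (snd X)) \<partial>lborel)"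
      using c(1) c'(1) by (simp add: integral_density_const case_prod_beta)
  qed
qed

section \<open>Fourier inversion and the quantisation formula\<close>

text \<open>A bounded left inverse supplies the lower bound on \<open>L\<close>.\<close>

lemma schwartz_compose_left_inverse:
  assumes f: "schwartz f" and L: "bounded_linear L" "bounded_linear L'" "\<And>x. L' (L x) = x"
  shows "schwartz (\<lambda>x. f (L x))"
proof -
  obtain B where B: "\<And>y. norm (L' y) \<le> norm y * B" using bounded_linear.bounded[OF L(2)] by blast
  have "norm x \<le> B * norm (L x)" for x
    using B[of "L x"] by (simp add: L(3) mult.commute)
  thus ?thesis by (rule schwartz_compose_linear[OF f L(1)])
qed

lemma schwartz_swap:
  assumes "schwartz f"
  shows "schwartz (\<lambda>X. f (snd X, fst X))"
  by (rule schwartz_compose_left_inverse[OF assms, where L = "\<lambda>X. (snd X, fst X)" and L' = "\<lambda>X. (snd X, fst X)"])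
    (auto intro: bounded_linear_Pair bounded_linear_fst bounded_linear_snd)

section \<open>Fubini, integrability and reflection for Lebesgue integrals\<close>

lemma integral_lborel_fst:
  fixes f :: "'a::euclidean_space \<times> 'b::euclidean_space \<Rightarrow> complex"
  assumes "integrable lborel f"
  shows "(\<integral>X. f X \<partial>lborel) = (\<integral>x. \<integral>y. f (x, y) \<partial>lborel \<partial>lborel)"
  using lborel_pair.integral_fst'[of f] assms by (simp add: lborel_prod)

lemma integral_lborel_swap:
  fixes f :: "'a::euclidean_space \<times> 'b::euclidean_space \<Rightarrow> complex"
  assumes "integrable lborel f"
  shows "(\<integral>x. \<integral>y. f (x, y) \<partial>lborel \<partial>lborel) = (\<integral>y. \<integral>x. f (x, y) \<partial>lborel \<partial>lborel)"
  using lborel_pair.Fubini_integral[of "\<lambda>x y. f (x, y)"] assms by (simp add: lborel_prod)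

lemma integrable_mult_bounded:
  fixes f g :: "'a::euclidean_space \<Rightarrow> complex"
  assumes "integrable lborel f" "g \<in> borel_measurable borel" "\<And>x. norm (g x) \<le> C"
  shows "integrable lborel (\<lambda>x. f x * g x)"
proof (rule Bochner_Integration.integrable_bound)
  show "integrable lborel (\<lambda>x. norm (f x) * C)" using assms(1) by simp
  show "(\<lambda>x. f x * g x) \<in> borel_measurable lborel" using assms(1,2) by simp
  have "norm (f x * g x) \<le> norm (norm (f x) * C)" for x
    unfolding norm_mult real_norm_def
    by (rule order_trans[OF mult_left_mono[OF assms(3)]]) auto
  thus "AE x in lborel. norm (f x * g x) \<le> norm (norm (f x) * C)" by simp
qed

lemma integrable_tensor:
  fixes f :: "'a::euclidean_space \<Rightarrow> complex" and g :: "'b::euclidean_space \<Rightarrow> complex"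
  assumes "integrable lborel f" "integrable lborel g"
  shows "integrable lborel (\<lambda>X. f (fst X) * g (snd X))"
proof -
  have [measurable]: "f \<in> borel_measurable borel" "g \<in> borel_measurable borel"
    using assms by (auto dest: borel_measurable_integrable)
  have "integrable (lborel \<Otimes>\<^sub>M lborel) (\<lambda>X. f (fst X) * g (snd X))"
  proof (rule lborel_pair.Fubini_integrable)
    show "(\<lambda>X. f (fst X) * g (snd X)) \<in> borel_measurable (lborel \<Otimes>\<^sub>M lborel)" by measurable
    show "integrable lborel (\<lambda>x. \<integral>y. norm (f (fst (x, y)) * g (snd (x, y))) \<partial>lborel)"
      using assms by (simp add: norm_mult)
    show "AE x in lborel. integrable lborel (\<lambda>y. f (fst (x, y)) * g (snd (x, y)))"
      using assms by simp
  qed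
  thus ?thesis by (simp add: lborel_prod)
qed

text \<open>The unit ball is symmetric, so reflection has Jacobian 1.\<close>

lemma integral_lborel_reflect:
  fixes f :: "'a::euclidean_space \<Rightarrow> complex"
  shows "(\<integral>x. f (- x) \<partial>lborel) = (\<integral>x. f x \<partial>lborel)"
proof -
  have "uminus ` cball 0 1 = cball (0 :: 'a) 1"
    by (auto simp: image_iff intro!: bexI[of _ "- _"])
  moreover have "0 < measure lborel (cball (0 :: 'a) 1)" by (rule content_cball_pos) simp
  ultimately have "abs_det (uminus :: 'a \<Rightarrow> 'a) = 1" by (simp add: abs_det_def)
  thus ?thesis
    using integral_linear_bij(2)[of uminus f] by (simp add: bij_uminus linear_uminus)
qed

lemma borel_measurable_partial_fourier:
  "schwartz f \<Longrightarrow> partial_fourier f \<in> borel_measurable borel"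
  by (intro schwartz_borel_measurable schwartz_partial_fourier)

text \<open>
  For \<open>dx\<close> and \<open>dp\<close> equal to \<open>c\<close> and \<open>c'\<close> times Lebesgue measure, \<open>K = (2\<pi>)\<^sup>-\<^sup>n c c'\<close>.
\<close>

definition fourier_inversion :: "complex \<Rightarrow> ('a::euclidean_space) itself \<Rightarrow> bool" where
  "fourier_inversion K _ \<longleftrightarrow> (\<forall>f :: 'a \<Rightarrow> complex. schwartz f \<longrightarrow> (\<forall>x. f x =
     K * (\<integral>q. cis (q \<bullet> x) * (\<integral>y. cis (- (q \<bullet> y)) * f y \<partial>lborel) \<partial>lborel)))"

text \<open>Inversion for \<open>s \<mapsto> f (- s)\<close> at \<open>- y\<close>. In
  \<open>w\<close> the transform with the positive phase acts first, the reverse of the order in the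
  assumed formula.\<close>

lemma fourier_inversion_reflected:
  fixes f :: "'a::euclidean_space \<Rightarrow> complex"
  assumes "fourier_inversion K TYPE('a)" "schwartz f"
  shows "f y = K * (\<integral>k. cis (- (k \<bullet> y)) * (\<integral>s. cis (s \<bullet> k) * f s \<partial>lborel) \<partial>lborel)"
proof -
  have "schwartz (\<lambda>s. f (- s))"
    by (rule schwartz_compose_left_inverse[OF assms(2), where L' = uminus])
      (auto intro: bounded_linear_minus bounded_linear_ident)
  hence 1: "f (- (- y)) = K * (\<integral>k. cis (k \<bullet> - y) * (\<integral>s. cis (- (k \<bullet> s)) * f (- s) \<partial>lborel) \<partial>lborel)"
    using assms(1) unfolding fourier_inversion_def by blast
  have "(\<integral>s. cis (- (k \<bullet> s)) * f (- s) \<partial>lborel) = (\<integral>s. cis (s \<bullet> k) * f s \<partial>lborel)" for k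
    using integral_lborel_reflect[of "\<lambda>s. cis (s \<bullet> k) * f s"] by (simp add: inner_commute)
  with 1 show ?thesis by simp
qed

lemma symplectic_fourier_partial_fourier:
  fixes f :: "'a::euclidean_space \<times> 'a \<Rightarrow> complex"
  assumes K: "fourier_inversion K TYPE('a)" and f: "schwartz f"
  shows "K * (\<integral>X. cis (q \<bullet> fst X - snd X \<bullet> y) * (\<integral>s. cis (snd X \<bullet> s) * f (fst X, s) \<partial>lborel) \<partial>lborel)
    = partial_fourier f (q, y)"
proof -
  \<comment> \<open>The transform is taken in the second variable, so arguments are swapped before
    and after. That it is Schwartz on pairs makes the integral against the plane wave absolutely
    convergent, which Fubini needs.\<close>
  let ?g = "\<lambda>X. partial_fourier (\<lambda>X. f (snd X, fst X)) (snd X, fst X)"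
  have g: "schwartz ?g"
    by (intro schwartz_swap[where f = "partial_fourier _"] schwartz_partial_fourier schwartz_swap f)
  have g_eq: "(\<integral>s. cis (k \<bullet> s) * f (z, s) \<partial>lborel) = ?g (z, k)" for z k
    by (simp add: partial_fourier_def inner_commute)
  have "integrable lborel (\<lambda>X. cis (q \<bullet> fst X - snd X \<bullet> y) * ?g X)"
    by (rule integrable_cis_mult[OF schwartz_integrable[OF g]])
      (intro borel_measurable_continuous_onI continuous_intros)
  from integral_lborel_fst[OF this]
  have "(\<integral>X. cis (q \<bullet> fst X - snd X \<bullet> y) * ?g X \<partial>lborel)
      = (\<integral>z. \<integral>k. cis (q \<bullet> z - k \<bullet> y) * ?g (z, k) \<partial>lborel \<partial>lborel)" by simp
  also have "\<dots> = (\<integral>z. cis (z \<bullet> q) * (\<integral>k. cis (- (k \<bullet> y)) * ?g (z, k) \<partial>lborel) \<partial>lborel)"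
    by (simp add: diff_conv_add_uminus cis_mult[symmetric] mult.assoc inner_commute[of q]
        del: add_uminus_conv_diff)
  finally have 1: "K * (\<integral>X. cis (q \<bullet> fst X - snd X \<bullet> y) * ?g X \<partial>lborel)
      = (\<integral>z. cis (z \<bullet> q) * (K * (\<integral>k. cis (- (k \<bullet> y)) * ?g (z, k) \<partial>lborel)) \<partial>lborel)"
    by (simp add: mult.left_commute[of _ K])
  have "K * (\<integral>k. cis (- (k \<bullet> y)) * ?g (z, k) \<partial>lborel) = f (z, y)" for z
    using fourier_inversion_reflected[OF K schwartz_section_snd[OF f, of z], of y]
    by (simp add: partial_fourier_def)
  with 1 have "K * (\<integral>X. cis (q \<bullet> fst X - snd X \<bullet> y) * ?g X \<partial>lborel) = partial_fourier f (q, y)"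
    by (simp only: partial_fourier_def[of f] fst_conv snd_conv)
  thus ?thesis by (simp add: g_eq)
qed

lemma symplectic_fourier_eq_iterated:
  fixes f :: "'a::euclidean_space \<times> 'a \<Rightarrow> complex"
  assumes f: "schwartz f"
  shows "(\<integral>X. cis (- (q \<bullet> fst X - snd X \<bullet> y)) * f X \<partial>lborel)
    = (\<integral>z. cis (- (q \<bullet> z)) * (\<integral>k. cis (k \<bullet> y) * f (z, k) \<partial>lborel) \<partial>lborel)"
proof -
  have "integrable lborel (\<lambda>X. cis (- (q \<bullet> fst X - snd X \<bullet> y)) * f X)"
    by (rule integrable_cis_mult[OF schwartz_integrable[OF f]])
      (intro borel_measurable_continuous_onI continuous_intros)
  from integral_lborel_fst[OF this]
  have "(\<integral>X. cis (- (q \<bullet> fst X - snd X \<bullet> y)) * f X \<partial>lborel)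
      = (\<integral>z. \<integral>k. cis (- (q \<bullet> z - k \<bullet> y)) * f (z, k) \<partial>lborel \<partial>lborel)" by simp
  also have "\<dots> = (\<integral>z. \<integral>k. cis (- (q \<bullet> z)) * (cis (k \<bullet> y) * f (z, k)) \<partial>lborel \<partial>lborel)"
    by (simp add: cis_mult mult.assoc[symmetric])
  finally show ?thesis by simp
qed

text \<open>The bilinear form of Parseval's identity in \<open>z\<close>, with \<open>y\<close> as a
  parameter: the transform is moved from \<open>f\<close> to the factor in front, where inversion
  recovers \<open>h\<close>.\<close>

lemma partial_fourier_parseval:
  fixes f h :: "'a::euclidean_space \<times> 'a \<Rightarrow> complex"
  assumes K: "fourier_inversion K TYPE('a)" and f: "schwartz f" and h: "schwartz h"
  shows "(\<integral>X. (K * (\<integral>z. cis (- (snd X \<bullet> z)) * h (z, fst X) \<partial>lborel)) *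
      partial_fourier f (snd X, fst X) \<partial>lborel) = (\<integral>X. f X * h X \<partial>lborel)"
proof -
  let ?F = "\<lambda>X. partial_fourier h (- snd X, fst X)"
  have F_eq: "(\<integral>z. cis (- (q \<bullet> z)) * h (z, y) \<partial>lborel) = ?F (y, q)" for q y
    by (simp add: partial_fourier_def inner_commute)
  have F: "schwartz ?F"
    by (rule schwartz_compose_left_inverse[where f = "partial_fourier h"
          and L = "\<lambda>X. (- snd X, fst X)" and L' = "\<lambda>X. (snd X, - fst X)"])
      ((intro h schwartz_partial_fourier bounded_linear_Pair bounded_linear_fst
        bounded_linear_snd bounded_linear_minus)+, simp)
  obtain C where C: "\<And>X. norm (partial_fourier f X) \<le> C" using partial_fourier_bounded[OF f] by metis
  obtain D where D: "\<And>X. norm (h X) \<le> D" using schwartz_bounded[OF h] by metis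
  have int: "integrable lborel (\<lambda>X. ?F X * partial_fourier f (snd X, fst X))"
    by (intro integrable_mult_bounded[where C = C] schwartz_integrable F C
        schwartz_borel_measurable schwartz_swap[where f = "partial_fourier f"] schwartz_partial_fourier f)
  have swap: "(\<integral>q. ?F (y, q) * partial_fourier f (q, y) \<partial>lborel)
      = (\<integral>z. f (z, y) * (\<integral>q. cis (q \<bullet> z) * ?F (y, q) \<partial>lborel) \<partial>lborel)" for y
  proof -
    \<comment> \<open>With \<open>y\<close> fixed the integrand is a phase times a tensor product in
      \<open>q\<close> and \<open>z\<close>, hence integrable; the triple integral is never
      considered.\<close>
    have int2: "integrable lborel (\<lambda>X. cis (fst X \<bullet> snd X) * (?F (y, fst X) * f (snd X, y)))"
      by (intro integrable_cis_mult integrable_tensor schwartz_integrable schwartz_section_snd[OF F]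
          schwartz_section_fst[OF f] borel_measurable_continuous_onI continuous_intros)
    have "(\<integral>q. ?F (y, q) * partial_fourier f (q, y) \<partial>lborel)
        = (\<integral>q. \<integral>z. cis (q \<bullet> z) * (?F (y, q) * f (z, y)) \<partial>lborel \<partial>lborel)"
      unfolding partial_fourier_def[of f]
      by (simp add: inner_commute mult.left_commute[of "cis _" "partial_fourier h _"])
    also have "\<dots> = (\<integral>z. \<integral>q. cis (q \<bullet> z) * (?F (y, q) * f (z, y)) \<partial>lborel \<partial>lborel)"
      using integral_lborel_swap[OF int2] by simp
    also have "\<dots> = (\<integral>z. (\<integral>q. cis (q \<bullet> z) * ?F (y, q) \<partial>lborel) * f (z, y) \<partial>lborel)"
      unfolding mult.assoc[symmetric] by simp
    finally show ?thesis by (simp add: mult.commute)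
  qed
  have inv: "K * (\<integral>q. cis (q \<bullet> z) * ?F (y, q) \<partial>lborel) = h (z, y)" for z y
    using K[unfolded fourier_inversion_def, rule_format, OF schwartz_section_fst[OF h, of y], of z]
    by (simp only: F_eq)
  have "(\<integral>X. (K * ?F X) * partial_fourier f (snd X, fst X) \<partial>lborel)
      = K * (\<integral>y. \<integral>q. ?F (y, q) * partial_fourier f (q, y) \<partial>lborel \<partial>lborel)"
    using integral_lborel_fst[OF int] by (simp add: mult.assoc)
  also have "\<dots> = (\<integral>y. \<integral>z. f (z, y) * (K * (\<integral>q. cis (q \<bullet> z) * ?F (y, q) \<partial>lborel)) \<partial>lborel \<partial>lborel)"
    unfolding swap by (simp add: mult.left_commute[of _ K])
  also have "\<dots> = (\<integral>y. \<integral>z. f (z, y) * h (z, y) \<partial>lborel \<partial>lborel)"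
    unfolding inv ..
  also have "\<dots> = (\<integral>z. \<integral>y. f (z, y) * h (z, y) \<partial>lborel \<partial>lborel)"
    by (rule integral_lborel_swap[symmetric, of "\<lambda>X. f X * h X"])
      (intro integrable_mult_bounded[where C = D] schwartz_integrable f schwartz_borel_measurable h D)
  also have "\<dots> = (\<integral>X. f X * h X \<partial>lborel)"
    by (rule integral_lborel_fst[symmetric, of "\<lambda>X. f X * h X"])
      (intro integrable_mult_bounded[where C = D] schwartz_integrable f schwartz_borel_measurable h D)
  finally show ?thesis by (simp only: F_eq fst_conv snd_conv prod.collapse)
qed

text \<open>Integrating over the momentum first exposes the distribution kernel of the operator,
  paired with the tensor product of \<open>u\<close> and \<open>v\<close>.\<close>

lemma op_schwartz_pairing:
  fixes b :: "'a::euclidean_space \<times> 'a \<Rightarrow> complex"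
  assumes b: "schwartz b" and u: "schwartz u" and v: "schwartz v"
    and th: "linear \<theta>" and ta: "linear \<tau>"
  shows "(\<integral>x. (\<integral>X. cis (snd X \<bullet> (x - fst X)) * b (\<theta> x + \<tau> (fst X), snd X) * v (fst X) \<partial>lborel) * u x \<partial>lborel)
    = (\<integral>X. u (fst X) * v (snd X) *
        (\<integral>k. cis (k \<bullet> (fst X - snd X)) * b (\<theta> (fst X) + \<tau> (snd X), k) \<partial>lborel) \<partial>lborel)"
proof -
  let ?H = "partial_fourier (\<lambda>X. b (snd X, fst X))"
  have H_eq: "(\<integral>k. cis (k \<bullet> y) * b (z, k) \<partial>lborel) = ?H (y, z)" for y z
    by (simp add: partial_fourier_def)
  have bl: "bounded_linear \<theta>" "bounded_linear \<tau>" using th ta by (simp_all add: linear_conv_bounded_linear)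
  have [measurable]: "\<theta> \<in> borel_measurable borel" "\<tau> \<in> borel_measurable borel"
    using bl by (auto intro: borel_measurable_continuous_onI linear_continuous_on)
  note [measurable] = schwartz_borel_measurable[OF u] schwartz_borel_measurable[OF v]
    schwartz_borel_measurable[OF b] borel_measurable_partial_fourier[OF schwartz_swap[OF b]]
  obtain C where C: "\<And>X. norm (?H X) \<le> C" using partial_fourier_bounded[OF schwartz_swap[OF b]] by metis
  \<comment> \<open>For fixed \<open>x\<close> the map
    \<open>y \<mapsto> \<theta> x + \<tau> y\<close> may be constant, so \<open>b\<close> need not
    decay in \<open>y\<close>. This bound, uniform in \<open>z\<close>, gives integrability in
    \<open>k\<close>; the factor \<open>v\<close> gives it in \<open>y\<close>.\<close>
  obtain D where D: "0 \<le> D" "\<And>k z. (1 + norm (k, z)) ^ 0 * norm (b (z, k)) \<le> D * decay_weight k"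
    using rapid_le_decay_weight[OF schwartz_rapid[OF schwartz_swap[OF b]], of 0]
    by (metis fst_conv snd_conv)
  have inner: "(\<integral>X. cis (snd X \<bullet> (x - fst X)) * b (\<theta> x + \<tau> (fst X), snd X) * v (fst X) \<partial>lborel)
      = (\<integral>y. v y * ?H (x - y, \<theta> x + \<tau> y) \<partial>lborel)" for x
  proof -
    have "integrable lborel (\<lambda>X. b (\<theta> x + \<tau> (fst X), snd X) * v (fst X))"
    proof (rule Bochner_Integration.integrable_bound)
      show "integrable lborel (\<lambda>X. v (fst X) * of_real (D * decay_weight (snd X)))"
        by (intro integrable_tensor[where g = "\<lambda>k. of_real (D * decay_weight k)"] schwartz_integrable v
            integrable_of_real integrable_mult_right integrable_decay_weight)
      show "(\<lambda>X. b (\<theta> x + \<tau> (fst X), snd X) * v (fst X)) \<in> borel_measurable lborel"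
        by (simp add: borel_prod[symmetric])
      have "norm (b (z, k) * w) \<le> norm (w * of_real (D * decay_weight k))" for z k w
        unfolding norm_mult norm_of_real
        using D(2)[of k z] by (subst mult.commute, intro mult_left_mono) auto
      thus "AE X in lborel. norm (b (\<theta> x + \<tau> (fst X), snd X) * v (fst X))
          \<le> norm (v (fst X) * of_real (D * decay_weight (snd X)))" by simp
    qed
    hence "integrable lborel (\<lambda>X. cis (snd X \<bullet> (x - fst X)) * (b (\<theta> x + \<tau> (fst X), snd X) * v (fst X)))"
      by (intro integrable_cis_mult borel_measurable_continuous_onI continuous_intros)
    from integral_lborel_fst[OF this] show ?thesis
      by (simp add: H_eq[symmetric] mult_ac)
  qed
  \<comment> \<open>The kernel is merely bounded; integrability comes from \<open>u\<close> and
    \<open>v\<close>.\<close>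
  have uv: "integrable lborel (\<lambda>X. u (fst X) * v (snd X) * ?H (fst X - snd X, \<theta> (fst X) + \<tau> (snd X)))"
  proof (rule integrable_mult_bounded[where C = C])
    show "integrable lborel (\<lambda>X. u (fst X) * v (snd X))"
      by (intro integrable_tensor schwartz_integrable u v)
    show "(\<lambda>X. ?H (fst X - snd X, \<theta> (fst X) + \<tau> (snd X))) \<in> borel_measurable borel"
      by (rule measurable_compose[OF _ borel_measurable_partial_fourier[OF schwartz_swap[OF b]]])
        (intro borel_measurable_continuous_onI continuous_intros bounded_linear.continuous_on[OF bl(1)]
          bounded_linear.continuous_on[OF bl(2)])
  qed (rule C)
  show ?thesis unfolding inner H_eq
    using integral_lborel_fst[OF uv] by (simp add: mult_ac)
qed

text \<open>Substituting \<open>x = y + s\<close>, the first component becomes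
  \<open>(\<theta> + \<tau>) y + \<theta> s\<close>. Finding a preimage of \<open>(z, s)\<close>
  thus means solving \<open>(\<theta> + \<tau>) y = z - \<theta> s\<close>.\<close>

lemma kernel_map_bij:
  fixes \<theta> \<tau> :: "'v::real_vector \<Rightarrow> 'v"
  assumes "linear \<theta>" "linear \<tau>" "bij (\<lambda>x. \<theta> x + \<tau> x)"
  shows "bij (\<lambda>(x, y). (\<theta> x + \<tau> y, x - y))"
proof (rule bijI)
  note lin = linear_add[OF assms(1)] linear_add[OF assms(2)] linear_diff[OF assms(1)] linear_diff[OF assms(2)]
  show "inj (\<lambda>(x, y). (\<theta> x + \<tau> y, x - y))"
  proof (rule injI, clarsimp)
    fix x y x' y' assume eq: "\<theta> x + \<tau> y = \<theta> x' + \<tau> y'" "x - y = x' - y'"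
    have yy: "y = y' + (x - x')" using eq(2) by (simp add: algebra_simps)
    have "\<theta> x + \<tau> x = (\<theta> x + \<tau> y) - \<tau> y' + \<tau> x'"
      unfolding yy lin(2,4) by simp
    also have "\<dots> = \<theta> x' + \<tau> x'" unfolding eq(1) by simp
    finally have "\<theta> x + \<tau> x = \<theta> x' + \<tau> x'" .
    hence "x = x'" by (rule injD[OF bij_is_inj[OF assms(3)]])
    with yy show "x = x' \<and> y = y'" by simp
  qed
  show "surj (\<lambda>(x, y). (\<theta> x + \<tau> y, x - y))"
  proof (rule surjI[where f = "\<lambda>(z, s). (let y = inv (\<lambda>x. \<theta> x + \<tau> x) (z - \<theta> s) in (y + s, y))"], clarsimp simp: Let_def)
    fix z s
    have "(\<lambda>x. \<theta> x + \<tau> x) (inv (\<lambda>x. \<theta> x + \<tau> x) (z - \<theta> s)) = z - \<theta> s"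
      using assms(3) by (meson bij_is_surj surj_f_inv_f)
    thus "\<theta> (inv (\<lambda>x. \<theta> x + \<tau> x) (z - \<theta> s) + s) + \<tau> (inv (\<lambda>x. \<theta> x + \<tau> x) (z - \<theta> s)) = z"
      by (simp add: lin algebra_simps)
  qed
qed

theorem proposition1p3:
  fixes dx :: "'v::euclidean_space measure"
    and dp :: "'v dual measure"
    and \<theta> \<tau> :: "'v \<Rightarrow> 'v"
    and a :: "'v \<times> 'v dual \<Rightarrow> complex"
  assumes "lebesgue_measure dx"
    and "dual_lebesgue_measure dx dp"
    and "linear \<theta>" and "linear \<tau>"
    and "bij (\<lambda>x. \<theta> x + \<tau> x)"
    and "schwartz a"
  shows "\<forall>u v. schwartz u \<longrightarrow> schwartz v \<longrightarrow>
           (let w = (\<lambda>Y. weyl_op dx dp \<theta> \<tau> Y v u) in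
             schwartz w \<and>
             distr_of dx (op_schwartz dx dp \<theta> \<tau> a v) u =
               (2 * pi) powi (- int DIM('v)) *
               (\<integral>Y. symplectic_fourier dx dp a Y * w Y \<partial>(dx \<Otimes>\<^sub>M dp)))"
proof -
  let ?J = "blinfun_inner_right :: 'v \<Rightarrow> 'v dual"
  define \<kappa> :: complex where "\<kappa> = (2 * pi) powi (- int DIM('v))"
  have dp: "lebesgue_measure dp" using assms(2) by (simp add: dual_lebesgue_measure_def)
  obtain c c' where c: "0 < c" "0 < c'"
    and int_dx: "\<And>f :: 'v \<Rightarrow> complex. (\<integral>x. f x \<partial>dx) = of_real c * (\<integral>x. f x \<partial>lborel)"
    and int_dp: "\<And>f :: 'v dual \<Rightarrow> complex. (\<integral>p. f p \<partial>dp) = of_real c' * (\<integral>q. f (?J q) \<partial>lborel)"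
    and int_dxdp: "\<And>f :: 'v \<times> 'v dual \<Rightarrow> complex. (\<integral>X. f X \<partial>(dx \<Otimes>\<^sub>M dp))
      = of_real (c * c') * (\<integral>X. f (fst X, ?J (snd X)) \<partial>lborel)"
    by (rule lebesgue_measures_coordinates[OF assms(1) dp]) (rule that)
  define K where "K = \<kappa> * of_real (c * c')"
  have inversion: "fourier_inversion K TYPE('v)"
    unfolding fourier_inversion_def
  proof (intro allI impI)
    fix f :: "'v \<Rightarrow> complex" and x assume "schwartz f"
    hence "f x = \<kappa> * (\<integral>p. cis (blinfun_apply p x) * (\<integral>y. cis (- blinfun_apply p y) * f y \<partial>dx) \<partial>dp)"
      using assms(2) unfolding dual_lebesgue_measure_def \<kappa>_def by blast
    thus "f x = K * (\<integral>q. cis (q \<bullet> x) * (\<integral>y. cis (- (q \<bullet> y)) * f y \<partial>lborel) \<partial>lborel)"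
      unfolding int_dx int_dp K_def by (simp add: mult_ac)
  qed
  define L where "L = (\<lambda>(x :: 'v, y). (\<theta> x + \<tau> y, x - y))"
  have bij: "bij L" unfolding L_def by (rule kernel_map_bij[OF assms(3,4,5)])
  have bl: "bounded_linear L"
  proof -
    have "bounded_linear (\<lambda>X :: 'v \<times> 'v. (\<theta> (fst X) + \<tau> (snd X), fst X - snd X))"
      using assms(3,4) unfolding linear_conv_bounded_linear
      by (intro bounded_linear_Pair bounded_linear_add bounded_linear_sub bounded_linear_fst
          bounded_linear_snd bounded_linear_compose[OF _ bounded_linear_fst]
          bounded_linear_compose[OF _ bounded_linear_snd])
    thus ?thesis by (simp add: L_def case_prod_beta')
  qed
  have lin: "linear L" using bl by (rule bounded_linear.linear)
  have inv_L: "L (inv L X) = X" "inv L (L X) = X" for X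
    using bij by (auto simp: bij_def surj_f_inv_f)
  have bl_inv: "bounded_linear (inv L)"
    using inj_linear_imp_inv_linear[OF lin bij_is_inj[OF bij]] by (simp add: linear_conv_bounded_linear)
  define d where "d = abs_det L"
  have d: "0 < d" "\<And>f :: 'v \<times> 'v \<Rightarrow> complex. (\<integral>X. f X \<partial>lborel) = of_real d * (\<integral>X. f (L X) \<partial>lborel)"
    unfolding d_def by (rule integral_linear_bij[OF lin bij])+
  define b where "b = (\<lambda>X. a (fst X, ?J (snd X)))"
  have b: "schwartz b"
    unfolding b_def
    by (rule schwartz_compose_left_inverse[OF assms(6), where L = "\<lambda>X. (fst X, ?J (snd X))"
          and L' = "\<lambda>X. (fst X, dual_coord (snd X))"])
      (intro bounded_linear_Pair bounded_linear_fst bounded_linear_compose[OF _ bounded_linear_snd]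
        bounded_linear_blinfun_inner_right bounded_linear_dual_coord | simp)+
  have main: "schwartz (\<lambda>Y. weyl_op dx dp \<theta> \<tau> Y v u) \<and>
      distr_of dx (op_schwartz dx dp \<theta> \<tau> a v) u =
        \<kappa> * (\<integral>Y. symplectic_fourier dx dp a Y * weyl_op dx dp \<theta> \<tau> Y v u \<partial>(dx \<Otimes>\<^sub>M dp))"
    if u: "schwartz u" and v: "schwartz v" for u v
  proof
    define \<psi> where "\<psi> = (\<lambda>Z. (\<lambda>(x, y). u x * v y) (inv L Z))"
    have psi: "schwartz \<psi>"
      unfolding \<psi>_def
      by (rule schwartz_compose_left_inverse[OF schwartz_tensor[OF u v] bl_inv bl inv_L(1)])
    have w: "weyl_op dx dp \<theta> \<tau> Y v u
        = of_real (inverse d * c) * partial_fourier \<psi> (dual_coord (snd Y), fst Y)" for Y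
    proof -
      obtain y p where Y: "Y = (y, p)" by (cases Y)
      define q where "q = dual_coord p"
      have p: "p = ?J q" by (simp add: q_def)
      have "weyl_op dx dp \<theta> \<tau> Y v u = of_real (inverse d) *
          (\<integral>X. cis (symplectic (y, p) X) *
            (\<lambda>(z, k). \<kappa> * (\<integral>s. cis (blinfun_apply k s) * \<psi> (z, s) \<partial>dx)) X \<partial>(dx \<Otimes>\<^sub>M dp))"
        unfolding weyl_op_def op_distr_def pullback_distr_def partial_inv_fourier_distr_def
          distr_of_def \<psi>_def d_def \<kappa>_def L_def Y ..
      \<comment> \<open>The factor \<open>inverse d\<close> stems from the pullback and one
        \<open>c\<close> from the inner integral over \<open>s\<close>; the outer
        \<open>c * c'\<close> joins \<open>\<kappa>\<close> in \<open>K\<close>.\<close>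
      also have "\<dots> = of_real (inverse d * c) *
          (K * (\<integral>X. cis (q \<bullet> fst X - snd X \<bullet> y) * (\<integral>s. cis (snd X \<bullet> s) * \<psi> (fst X, s) \<partial>lborel) \<partial>lborel))"
        unfolding int_dx int_dxdp p K_def by (simp add: mult_ac)
      also have "\<dots> = of_real (inverse d * c) * partial_fourier \<psi> (q, y)"
        unfolding symplectic_fourier_partial_fourier[OF inversion psi] ..
      finally show ?thesis by (simp add: Y q_def)
    qed
    have "schwartz (\<lambda>Y. partial_fourier \<psi> (dual_coord (snd Y), fst Y))"
      by (rule schwartz_compose_left_inverse[OF schwartz_partial_fourier[OF psi],
            where L = "\<lambda>Y. (dual_coord (snd Y), fst Y)" and L' = "\<lambda>X. (snd X, ?J (fst X))"])
        (intro bounded_linear_Pair bounded_linear_fst bounded_linear_snd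
          bounded_linear_compose[OF _ bounded_linear_snd] bounded_linear_compose[OF _ bounded_linear_fst]
          bounded_linear_blinfun_inner_right bounded_linear_dual_coord | simp)+
    thus "schwartz (\<lambda>Y. weyl_op dx dp \<theta> \<tau> Y v u)"
      unfolding w by (rule schwartz_cmult)
    let ?H = "\<lambda>X. \<integral>k. cis (k \<bullet> snd X) * b (fst X, k) \<partial>lborel"
    have H: "schwartz ?H"
      using schwartz_swap[OF schwartz_partial_fourier[OF schwartz_swap[OF b]]]
      by (simp add: partial_fourier_def)
    have sf: "symplectic_fourier dx dp a (y, ?J q) = K * (\<integral>z. cis (- (q \<bullet> z)) * ?H (z, y) \<partial>lborel)" for y q
    proof -
      have "symplectic_fourier dx dp a (y, ?J q)
          = K * (\<integral>X. cis (- (q \<bullet> fst X - snd X \<bullet> y)) * b X \<partial>lborel)"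
        unfolding symplectic_fourier_def \<kappa>_def[symmetric] int_dxdp K_def b_def
        by (simp add: mult.assoc)
      thus ?thesis by (simp only: symplectic_fourier_eq_iterated[OF b] fst_conv snd_conv)
    qed
    have "\<kappa> * (\<integral>Y. symplectic_fourier dx dp a Y * weyl_op dx dp \<theta> \<tau> Y v u \<partial>(dx \<Otimes>\<^sub>M dp))
        = K * (\<integral>X. symplectic_fourier dx dp a (fst X, ?J (snd X)) *
            (of_real (inverse d * c) * partial_fourier \<psi> (snd X, fst X)) \<partial>lborel)"
      unfolding int_dxdp w K_def fst_conv snd_conv dual_coord_inverse by (simp only: mult.assoc)
    \<comment> \<open>The second \<open>K\<close> is the normalisation of the symplectic transform
      and is spent on inversion in the Parseval identity; the first remains.\<close>
    also have "\<dots> = of_real (inverse d * c) * K *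
        (\<integral>X. (K * (\<integral>z. cis (- (snd X \<bullet> z)) * ?H (z, fst X) \<partial>lborel)) *
          partial_fourier \<psi> (snd X, fst X) \<partial>lborel)"
      unfolding sf mult.left_commute[of _ "of_real (inverse d * c)"]
      by (simp only: integral_mult_right_zero mult_ac)
    also have "\<dots> = of_real (inverse d * c) * K * (\<integral>X. \<psi> X * ?H X \<partial>lborel)"
      unfolding partial_fourier_parseval[OF inversion psi H] ..
    \<comment> \<open>The Jacobian of the substitution cancels the \<open>inverse d\<close> carried
      by \<open>w\<close>.\<close>
    also have "\<dots> = of_real c * K * (\<integral>X. \<psi> (L X) * ?H (L X) \<partial>lborel)"
      using d(1) by (simp add: d(2)[of "\<lambda>X. \<psi> X * ?H X"])
    also have "\<dots> = of_real c * K * (\<integral>X. u (fst X) * v (snd X) *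
        (\<integral>k. cis (k \<bullet> (fst X - snd X)) * b (\<theta> (fst X) + \<tau> (snd X), k) \<partial>lborel) \<partial>lborel)"
      unfolding \<psi>_def inv_L by (simp add: L_def case_prod_beta)
    also have "\<dots> = of_real c * K * (\<integral>x. (\<integral>X. cis (snd X \<bullet> (x - fst X)) *
        b (\<theta> x + \<tau> (fst X), snd X) * v (fst X) \<partial>lborel) * u x \<partial>lborel)"
      unfolding op_schwartz_pairing[OF b u v assms(3,4)] ..
    \<comment> \<open>The remaining \<open>c\<close> belongs to the pairing over \<open>dx\<close>,
      and \<open>K\<close> is the constant of the operator together with the factors of its two
      measures.\<close>
    also have "\<dots> = distr_of dx (op_schwartz dx dp \<theta> \<tau> a v) u"
      unfolding distr_of_def op_schwartz_def \<kappa>_def[symmetric] int_dx int_dxdp K_def b_def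
      by (simp add: mult.assoc)
    finally show "distr_of dx (op_schwartz dx dp \<theta> \<tau> a v) u =
        \<kappa> * (\<integral>Y. symplectic_fourier dx dp a Y * weyl_op dx dp \<theta> \<tau> Y v u \<partial>(dx \<Otimes>\<^sub>M dp))" ..
  qed
  thus ?thesis unfolding Let_def \<kappa>_def by blast
qed

end
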